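(* Let $C$ be a group and $(B,\xi)$ a $C$-module, i.e. an abelian group $B$ with an action $\xi$ of $C$. The assignment $\Phi$, sending an abelian extension $B\xrightarrow{\kappa}E\xrightarrow{\gamma}C$ with induced action $\xi$ to the butterfly $I_\xi\to I_\xi$ with group $E$ and maps $-\kappa\colon B\to E$, $\kappa\colon B\to E$, $\gamma\colon E\to C$, $\gamma\colon E\to C$, gives rise to a symmetric strict monoidal equivalence between the symmetric $2$-groups $\mathsf{H}^2(C,B,\xi)$ and $\mathsf{Eq}(I_\xi)$.
   Context: All groups are written additively. A $2$-group is a (not necessarily strict) monoidal groupoid in which every object is invertible with respect to the tensor product up to isomorphism. $\mathsf{H}^2(C,B,\xi)$: its underlying groupoid $\mathsf{OpExt}(C,B,\xi)$ has as objects the short exact sequences of groups $B\xrightarrow{\kappa}E\xrightarrow{\gamma}C$ such that the action of $C$ on $B$ induced by conjugation in $E$ is $\xi$, and as arrows the homomorphisms of the middle groups commuting with the maps from $B$ and to $C$. The tensor product is the Baer sum (before passing to isomorphism classes): for $(\kappa,\gamma)$ on $E$ and $(\kappa',\gamma')$ on $E'$, take the pullback $E\times_CE'$ of $\gamma$ and $\gamma'$, with its kernel $\kappa\times_C\kappa'\colon B\times B\to E\times_CE'$ over $C$, and then push this extension forward along the codiagonal $[1,1]\colon B\times B\to B$, obtaining $B\xrightarrow{\bar\kappa}E\oplus E'\xrightarrow{\bar\gamma}C$. The unit is $B\to B\rtimes_\xi C\to C$. The symmetry is induced by the exchange $E\times_CE'\cong E'\times_CE$. $I_\xi$: the crossed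 extension $0\to B\xrightarrow{1}B\xrightarrow{0}C\xrightarrow{1}C\to0$, where $0\colon B\to C$ is a crossed module with action $\xi$. $\mathsf{Eq}(I_\xi)$: its objects are the butterflies from $I_\xi$ to itself of the form $(E,-\kappa,\kappa,\gamma,\gamma)$. Explicitly, such a butterfly consists of a group $E$ and homomorphisms $-\kappa,\kappa\colon B\to E$ (from the $B$ of the domain and the $B$ of the codomain copy of $I_\xi$, respectively) and $\gamma,\gamma\colon E\to C$ (to the $C$ of the domain and of the codomain copy), such that $0\to B\xrightarrow{\kappa}E\xrightarrow{\gamma}C\to0$ is exact and $\kappa(\gamma(e)*b)=e+\kappa(b)-e$ for all $e\in E$, $b\in B$, where $*$ is the action $\xi$. Its arrows $(E,-\kappa,\kappa,\gamma,\gamma)\to(E',-\kappa',\kappa',\gamma',\gamma')$ are the isomorphisms $\sigma\colon E\to E'$ with $\sigma\kappa=\kappa'$ and $\gamma'\sigma=\gamma$. The tensor product of $E$ and $E'$ is given by the butterfly composite $E'\cdot E$. This is computed by taking the cokernel $q\colon E\times_CE'\to E'\cdot E$ of $\langle\kappa,-\kappa'\rangle\colon B\to E\times_CE'$. The maps from the domain and codomain copies of $B$ are $q\langle-\kappa,0\rangle$ and $q\langle0,\kappa'\rangle$, and the two maps to $C$ are those induced by $\gamma p_1$ and $\gamma'p_2$, with $p_1,p_2$ the pullback projections. The unit is the identity butterfly, with group $B\rtimes_\xi C$, maps $-i_B,i_B$ from $B$ and the projection $p_C$ to $C$ (twice). The symmetry $E'\cdot E\cong E\cdot E'$ is the canonical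 isomorphism induced by the exchange $E\times_CE'\cong E'\times_CE$ through the universal properties used in the composition. Pushforwards and cokernels are determined only up to canonical isomorphism; strict monoidality is understood for compatible choices of these in the definitions of the Baer sum and of butterfly composition, and means $\Phi(E\oplus E')=\Phi(E')\cdot\Phi(E)$ and that $\Phi$ sends the unit to the unit. *)

theory Defs
  imports "HOL-Algebra.Weak_Morphisms" "HOL-Algebra.Bij"
begin

section \<open>Symmetric monoidal categories and symmetric 2-groups\<close>

text \<open>
  Hom-sets of different pairs of objects may overlap, so the identities, the composition and the
  tensor product of arrows take the objects involved as arguments:
  \<open>cmp M a b c g f\<close> is the composite of \<open>f : a \<rightarrow> b\<close> and \<open>g : b \<rightarrow> c\<close>, and
  \<open>tarr M a a' b b' f g\<close> is the tensor product of \<open>f : a \<rightarrow> a'\<close> and \<open>g : b \<rightarrow> b'\<close>.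
  Further, \<open>assc M a b c : (a \<otimes> b) \<otimes> c \<rightarrow> a \<otimes> (b \<otimes> c)\<close>,
  \<open>lun M a : I \<otimes> a \<rightarrow> a\<close>, \<open>run M a : a \<otimes> I \<rightarrow> a\<close> and \<open>symm M a b : a \<otimes> b \<rightarrow> b \<otimes> a\<close>.
\<close>

record ('o, 'a) cat =
  objs :: "'o set"
  homs :: "'o \<Rightarrow> 'o \<Rightarrow> 'a set"
  idn :: "'o \<Rightarrow> 'a"
  cmp :: "'o \<Rightarrow> 'o \<Rightarrow> 'o \<Rightarrow> 'a \<Rightarrow> 'a \<Rightarrow> 'a"

record ('o, 'a) smcat = "('o, 'a) cat" +
  tens :: "'o \<Rightarrow> 'o \<Rightarrow> 'o"
  tunit :: "'o"
  tarr :: "'o \<Rightarrow> 'o \<Rightarrow> 'o \<Rightarrow> 'o \<Rightarrow> 'a \<Rightarrow> 'a \<Rightarrow> 'a"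
  assc :: "'o \<Rightarrow> 'o \<Rightarrow> 'o \<Rightarrow> 'a"
  lun :: "'o \<Rightarrow> 'a"
  run :: "'o \<Rightarrow> 'a"
  symm :: "'o \<Rightarrow> 'o \<Rightarrow> 'a"

definition is_isomorphism ::
    "('o, 'a, 'z) cat_scheme \<Rightarrow> 'o \<Rightarrow> 'o \<Rightarrow> 'a \<Rightarrow> bool" where
  "is_isomorphism M a b f \<longleftrightarrow> f \<in> homs M a b \<and>
     (\<exists>g \<in> homs M b a. cmp M a b a g f = idn M a \<and> cmp M b a b f g = idn M b)"

definition isomorphic_in :: "('o, 'a, 'z) cat_scheme \<Rightarrow> 'o \<Rightarrow> 'o \<Rightarrow> bool" where
  "isomorphic_in M a b \<longleftrightarrow> (\<exists>f. is_isomorphism M a b f)"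

locale category =
  fixes M :: "('o, 'a, 'z) cat_scheme"
  assumes idn_in: "a \<in> objs M \<Longrightarrow> idn M a \<in> homs M a a"
    and cmp_in: "\<lbrakk>a \<in> objs M; b \<in> objs M; c \<in> objs M; f \<in> homs M a b; g \<in> homs M b c\<rbrakk>
      \<Longrightarrow> cmp M a b c g f \<in> homs M a c"
    and cmp_idn_right: "\<lbrakk>a \<in> objs M; b \<in> objs M; f \<in> homs M a b\<rbrakk>
      \<Longrightarrow> cmp M a a b f (idn M a) = f"
    and cmp_idn_left: "\<lbrakk>a \<in> objs M; b \<in> objs M; f \<in> homs M a b\<rbrakk>
      \<Longrightarrow> cmp M a b b (idn M b) f = f"
    and cmp_assoc: "\<lbrakk>a \<in> objs M; b \<in> objs M; c \<in> objs M; d \<in> objs M;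
        f \<in> homs M a b; g \<in> homs M b c; h \<in> homs M c d\<rbrakk>
      \<Longrightarrow> cmp M a b d (cmp M b c d h g) f = cmp M a c d h (cmp M a b c g f)"

locale groupoid = category M for M :: "('o, 'a, 'z) cat_scheme" +
  assumes all_iso: "\<lbrakk>a \<in> objs M; b \<in> objs M; f \<in> homs M a b\<rbrakk> \<Longrightarrow> is_isomorphism M a b f"

locale symmetric_monoidal_category = category M for M :: "('o, 'a, 'z) smcat_scheme" +
  assumes tens_in: "\<lbrakk>a \<in> objs M; b \<in> objs M\<rbrakk> \<Longrightarrow> tens M a b \<in> objs M"
    and tunit_in: "tunit M \<in> objs M"
    and tarr_in: "\<lbrakk>a \<in> objs M; a' \<in> objs M; b \<in> objs M; b' \<in> objs M;
        f \<in> homs M a a'; g \<in> homs M b b'\<rbrakk>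
      \<Longrightarrow> tarr M a a' b b' f g \<in> homs M (tens M a b) (tens M a' b')"
    and tarr_idn: "\<lbrakk>a \<in> objs M; b \<in> objs M\<rbrakk>
      \<Longrightarrow> tarr M a a b b (idn M a) (idn M b) = idn M (tens M a b)"
    and tarr_cmp: "\<lbrakk>a \<in> objs M; a' \<in> objs M; a'' \<in> objs M; b \<in> objs M; b' \<in> objs M; b'' \<in> objs M;
        f \<in> homs M a a'; f' \<in> homs M a' a''; g \<in> homs M b b'; g' \<in> homs M b' b''\<rbrakk>
      \<Longrightarrow> tarr M a a'' b b'' (cmp M a a' a'' f' f) (cmp M b b' b'' g' g) =
          cmp M (tens M a b) (tens M a' b') (tens M a'' b'')
            (tarr M a' a'' b' b'' f' g') (tarr M a a' b b' f g)"
    and assc_iso: "\<lbrakk>a \<in> objs M; b \<in> objs M; c \<in> objs M\<rbrakk>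
      \<Longrightarrow> is_isomorphism M (tens M (tens M a b) c) (tens M a (tens M b c)) (assc M a b c)"
    and assc_natural: "\<lbrakk>a \<in> objs M; a' \<in> objs M; b \<in> objs M; b' \<in> objs M; c \<in> objs M; c' \<in> objs M;
        f \<in> homs M a a'; g \<in> homs M b b'; h \<in> homs M c c'\<rbrakk>
      \<Longrightarrow> cmp M (tens M (tens M a b) c) (tens M (tens M a' b') c') (tens M a' (tens M b' c'))
            (assc M a' b' c')
            (tarr M (tens M a b) (tens M a' b') c c' (tarr M a a' b b' f g) h) =
          cmp M (tens M (tens M a b) c) (tens M a (tens M b c)) (tens M a' (tens M b' c'))
            (tarr M a a' (tens M b c) (tens M b' c') f (tarr M b b' c c' g h))
            (assc M a b c)"
    and lun_iso: "a \<in> objs M \<Longrightarrow> is_isomorphism M (tens M (tunit M) a) a (lun M a)"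
    and lun_natural: "\<lbrakk>a \<in> objs M; a' \<in> objs M; f \<in> homs M a a'\<rbrakk>
      \<Longrightarrow> cmp M (tens M (tunit M) a) (tens M (tunit M) a') a' (lun M a')
            (tarr M (tunit M) (tunit M) a a' (idn M (tunit M)) f) =
          cmp M (tens M (tunit M) a) a a' f (lun M a)"
    and run_iso: "a \<in> objs M \<Longrightarrow> is_isomorphism M (tens M a (tunit M)) a (run M a)"
    and run_natural: "\<lbrakk>a \<in> objs M; a' \<in> objs M; f \<in> homs M a a'\<rbrakk>
      \<Longrightarrow> cmp M (tens M a (tunit M)) (tens M a' (tunit M)) a' (run M a')
            (tarr M a a' (tunit M) (tunit M) f (idn M (tunit M))) =
          cmp M (tens M a (tunit M)) a a' f (run M a)"
    and symm_iso: "\<lbrakk>a \<in> objs M; b \<in> objs M\<rbrakk>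
      \<Longrightarrow> is_isomorphism M (tens M a b) (tens M b a) (symm M a b)"
    and symm_natural: "\<lbrakk>a \<in> objs M; a' \<in> objs M; b \<in> objs M; b' \<in> objs M;
        f \<in> homs M a a'; g \<in> homs M b b'\<rbrakk>
      \<Longrightarrow> cmp M (tens M a b) (tens M a' b') (tens M b' a') (symm M a' b') (tarr M a a' b b' f g) =
          cmp M (tens M a b) (tens M b a) (tens M b' a') (tarr M b b' a a' g f) (symm M a b)"
    and pentagon: "\<lbrakk>a \<in> objs M; b \<in> objs M; c \<in> objs M; d \<in> objs M\<rbrakk>
      \<Longrightarrow> cmp M (tens M (tens M (tens M a b) c) d) (tens M (tens M a b) (tens M c d))
              (tens M a (tens M b (tens M c d)))
            (assc M a b (tens M c d)) (assc M (tens M a b) c d) =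
          cmp M (tens M (tens M (tens M a b) c) d) (tens M a (tens M (tens M b c) d))
              (tens M a (tens M b (tens M c d)))
            (tarr M a a (tens M (tens M b c) d) (tens M b (tens M c d)) (idn M a) (assc M b c d))
            (cmp M (tens M (tens M (tens M a b) c) d) (tens M (tens M a (tens M b c)) d)
                (tens M a (tens M (tens M b c) d))
              (assc M a (tens M b c) d)
              (tarr M (tens M (tens M a b) c) (tens M a (tens M b c)) d d (assc M a b c) (idn M d)))"
    and triangle: "\<lbrakk>a \<in> objs M; b \<in> objs M\<rbrakk>
      \<Longrightarrow> cmp M (tens M (tens M a (tunit M)) b) (tens M a (tens M (tunit M) b)) (tens M a b)
            (tarr M a a (tens M (tunit M) b) b (idn M a) (lun M b)) (assc M a (tunit M) b) =
          tarr M (tens M a (tunit M)) a b b (run M a) (idn M b)"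
    and hexagon: "\<lbrakk>a \<in> objs M; b \<in> objs M; c \<in> objs M\<rbrakk>
      \<Longrightarrow> cmp M (tens M (tens M a b) c) (tens M (tens M b c) a) (tens M b (tens M c a))
            (assc M b c a)
            (cmp M (tens M (tens M a b) c) (tens M a (tens M b c)) (tens M (tens M b c) a)
              (symm M a (tens M b c)) (assc M a b c)) =
          cmp M (tens M (tens M a b) c) (tens M b (tens M a c)) (tens M b (tens M c a))
            (tarr M b b (tens M a c) (tens M c a) (idn M b) (symm M a c))
            (cmp M (tens M (tens M a b) c) (tens M (tens M b a) c) (tens M b (tens M a c))
              (assc M b a c)
              (tarr M (tens M a b) (tens M b a) c c (symm M a b) (idn M c)))"
    and symm_symm: "\<lbrakk>a \<in> objs M; b \<in> objs M\<rbrakk>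
      \<Longrightarrow> cmp M (tens M a b) (tens M b a) (tens M a b) (symm M b a) (symm M a b) = idn M (tens M a b)"

locale symmetric_two_group =
  symmetric_monoidal_category M + groupoid M for M :: "('o, 'a, 'z) smcat_scheme" +
  assumes invertible: "a \<in> objs M \<Longrightarrow> \<exists>b \<in> objs M.
      isomorphic_in M (tens M a b) (tunit M) \<and> isomorphic_in M (tens M b a) (tunit M)"

locale cat_functor =
  fixes M :: "('o, 'a, 'y) cat_scheme" and N :: "('p, 'b, 'z) cat_scheme"
    and Fo :: "'o \<Rightarrow> 'p" and Fa :: "'o \<Rightarrow> 'o \<Rightarrow> 'a \<Rightarrow> 'b"
  assumes Fo_in: "a \<in> objs M \<Longrightarrow> Fo a \<in> objs N"
    and Fa_in: "\<lbrakk>a \<in> objs M; b \<in> objs M; f \<in> homs M a b\<rbrakk> \<Longrightarrow> Fa a b f \<in> homs N (Fo a) (Fo b)"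
    and Fa_idn: "a \<in> objs M \<Longrightarrow> Fa a a (idn M a) = idn N (Fo a)"
    and Fa_cmp: "\<lbrakk>a \<in> objs M; b \<in> objs M; c \<in> objs M; f \<in> homs M a b; g \<in> homs M b c\<rbrakk>
      \<Longrightarrow> Fa a c (cmp M a b c g f) = cmp N (Fo a) (Fo b) (Fo c) (Fa b c g) (Fa a b f)"

definition natural_isomorphism ::
    "('o, 'a, 'y) cat_scheme \<Rightarrow> ('p, 'b, 'z) cat_scheme \<Rightarrow>
     ('o \<Rightarrow> 'p) \<Rightarrow> ('o \<Rightarrow> 'o \<Rightarrow> 'a \<Rightarrow> 'b) \<Rightarrow> ('o \<Rightarrow> 'p) \<Rightarrow> ('o \<Rightarrow> 'o \<Rightarrow> 'a \<Rightarrow> 'b) \<Rightarrow>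
     ('o \<Rightarrow> 'b) \<Rightarrow> bool" where
  "natural_isomorphism M N Fo Fa Go Ga \<eta> \<longleftrightarrow>
     (\<forall>a \<in> objs M. is_isomorphism N (Fo a) (Go a) (\<eta> a)) \<and>
     (\<forall>a \<in> objs M. \<forall>b \<in> objs M. \<forall>f \<in> homs M a b.
        cmp N (Fo a) (Fo b) (Go b) (\<eta> b) (Fa a b f) = cmp N (Fo a) (Go a) (Go b) (Ga a b f) (\<eta> a))"

definition equivalence_of_categories ::
    "('o, 'a, 'y) cat_scheme \<Rightarrow> ('p, 'b, 'z) cat_scheme \<Rightarrow>
     ('o \<Rightarrow> 'p) \<Rightarrow> ('o \<Rightarrow> 'o \<Rightarrow> 'a \<Rightarrow> 'b) \<Rightarrow> bool" where
  "equivalence_of_categories M N Fo Fa \<longleftrightarrow> cat_functor M N Fo Fa \<and>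
     (\<exists>Go Ga \<eta> \<epsilon>. cat_functor N M Go Ga \<and>
        natural_isomorphism M M (\<lambda>a. a) (\<lambda>a b f. f)
          (\<lambda>a. Go (Fo a)) (\<lambda>a b f. Ga (Fo a) (Fo b) (Fa a b f)) \<eta> \<and>
        natural_isomorphism N N (\<lambda>x. Fo (Go x)) (\<lambda>x y g. Fa (Go x) (Go y) (Ga x y g))
          (\<lambda>x. x) (\<lambda>x y g. g) \<epsilon>)"

locale symmetric_strict_monoidal_functor = cat_functor M N Fo Fa
  for M :: "('o, 'a, 'y) smcat_scheme" and N :: "('p, 'b, 'z) smcat_scheme"
    and Fo :: "'o \<Rightarrow> 'p" and Fa :: "'o \<Rightarrow> 'o \<Rightarrow> 'a \<Rightarrow> 'b" +
  assumes Fo_tens: "\<lbrakk>a \<in> objs M; b \<in> objs M\<rbrakk> \<Longrightarrow> Fo (tens M a b) = tens N (Fo a) (Fo b)"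
    and Fo_tunit: "Fo (tunit M) = tunit N"
    and Fa_tarr: "\<lbrakk>a \<in> objs M; a' \<in> objs M; b \<in> objs M; b' \<in> objs M;
        f \<in> homs M a a'; g \<in> homs M b b'\<rbrakk>
      \<Longrightarrow> Fa (tens M a b) (tens M a' b') (tarr M a a' b b' f g) =
          tarr N (Fo a) (Fo a') (Fo b) (Fo b') (Fa a a' f) (Fa b b' g)"
    and Fa_assc: "\<lbrakk>a \<in> objs M; b \<in> objs M; c \<in> objs M\<rbrakk>
      \<Longrightarrow> Fa (tens M (tens M a b) c) (tens M a (tens M b c)) (assc M a b c) =
          assc N (Fo a) (Fo b) (Fo c)"
    and Fa_lun: "a \<in> objs M \<Longrightarrow> Fa (tens M (tunit M) a) a (lun M a) = lun N (Fo a)"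
    and Fa_run: "a \<in> objs M \<Longrightarrow> Fa (tens M a (tunit M)) a (run M a) = run N (Fo a)"
    and Fa_symm: "\<lbrakk>a \<in> objs M; b \<in> objs M\<rbrakk>
      \<Longrightarrow> Fa (tens M a b) (tens M b a) (symm M a b) = symm N (Fo a) (Fo b)"

definition symmetric_strict_monoidal_equivalence ::
    "('o, 'a, 'y) smcat_scheme \<Rightarrow> ('p, 'b, 'z) smcat_scheme \<Rightarrow>
     ('o \<Rightarrow> 'p) \<Rightarrow> ('o \<Rightarrow> 'o \<Rightarrow> 'a \<Rightarrow> 'b) \<Rightarrow> bool" where
  "symmetric_strict_monoidal_equivalence M N Fo Fa \<longleftrightarrow>
     symmetric_strict_monoidal_functor M N Fo Fa \<and> equivalence_of_categories M N Fo Fa"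


section \<open>Group-theoretic preliminaries\<close>

text \<open>
  Groups are those of \<open>HOL-Algebra\<close>, hence written multiplicatively: the additive
  \<open>e + e'\<close>, \<open>- e\<close>, \<open>0\<close> become \<open>e \<otimes> e'\<close>, \<open>inv e\<close>, \<open>\<one>\<close>. Homomorphisms that are part of an object or
  an arrow are extensional, i.e. they have the value \<open>undefined\<close> outside the carrier, so that
  equality of functions is equality of homomorphisms.
\<close>

definition ehom :: "('a, 'm) monoid_scheme \<Rightarrow> ('b, 'n) monoid_scheme \<Rightarrow> ('a \<Rightarrow> 'b) set" where
  "ehom G H = hom G H \<inter> extensional (carrier G)"

definition group_module :: "'c monoid \<Rightarrow> 'b monoid \<Rightarrow> ('c \<Rightarrow> 'b \<Rightarrow> 'b) \<Rightarrow> bool" where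
  "group_module C B \<xi> \<longleftrightarrow> group C \<and> comm_group B \<and> \<xi> \<in> hom C (AutoGroup B)"

definition pullback_group ::
    "'x monoid \<Rightarrow> 'y monoid \<Rightarrow> ('x \<Rightarrow> 'c) \<Rightarrow> ('y \<Rightarrow> 'c) \<Rightarrow> ('x \<times> 'y) monoid" where
  "pullback_group G H f g =
     (G \<times>\<times> H) \<lparr>carrier := {(x, y). x \<in> carrier G \<and> y \<in> carrier H \<and> f x = g y}\<rparr>"

definition semidirect :: "'c monoid \<Rightarrow> 'b monoid \<Rightarrow> ('c \<Rightarrow> 'b \<Rightarrow> 'b) \<Rightarrow> ('b \<times> 'c) monoid" where
  "semidirect C B \<xi> =
     \<lparr>carrier = carrier B \<times> carrier C,
      monoid.mult = (\<lambda>(b, c) (b', c'). (b \<otimes>\<^bsub>B\<^esub> \<xi> c b', c \<otimes>\<^bsub>C\<^esub> c')),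
      one = (\<one>\<^bsub>B\<^esub>, \<one>\<^bsub>C\<^esub>)\<rparr>"

text \<open>
  The image of \<open>f\<close> need not be normal, so the kernel of the cokernel of \<open>f : H \<rightarrow> G\<close> is the normal
  closure of that image.
\<close>

definition is_cokernel ::
    "'h monoid \<Rightarrow> 'g monoid \<Rightarrow> ('h \<Rightarrow> 'g) \<Rightarrow> 'q monoid \<Rightarrow> ('g \<Rightarrow> 'q) \<Rightarrow> bool" where
  "is_cokernel H G f Q q \<longleftrightarrow> group Q \<and> q \<in> ehom G Q \<and> q ` carrier G = carrier Q \<and>
     kernel G Q q = \<Inter>{N. N \<lhd> G \<and> f ` carrier H \<subseteq> N}"

text \<open>
  The map on \<open>Q\<close> induced by \<open>f\<close> through a surjection \<open>q : D \<rightarrow> carrier Q\<close>.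
\<close>

definition induced :: "'d set \<Rightarrow> 'q monoid \<Rightarrow> ('d \<Rightarrow> 'q) \<Rightarrow> ('d \<Rightarrow> 'r) \<Rightarrow> 'q \<Rightarrow> 'r" where
  "induced D Q q f = (THE h. h \<in> extensional (carrier Q) \<and> (\<forall>x \<in> D. h (q x) = f x))"


section \<open>The symmetric 2-group of extensions\<close>

record ('b, 'c, 'e) extn =
  egrp :: "'e monoid"
  incl :: "'b \<Rightarrow> 'e"
  proj :: "'e \<Rightarrow> 'c"

definition is_extension :: "'c monoid \<Rightarrow> 'b monoid \<Rightarrow> ('b, 'c, 'e) extn \<Rightarrow> bool" where
  "is_extension C B X \<longleftrightarrow> group C \<and> group B \<and> group (egrp X) \<and>
     incl X \<in> ehom B (egrp X) \<and> inj_on (incl X) (carrier B) \<and>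
     proj X \<in> ehom (egrp X) C \<and> proj X ` carrier (egrp X) = carrier C \<and>
     kernel (egrp X) C (proj X) = incl X ` carrier B"

definition opext :: "'c monoid \<Rightarrow> 'b monoid \<Rightarrow> ('c \<Rightarrow> 'b \<Rightarrow> 'b) \<Rightarrow> ('b, 'c, 'e) extn set" where
  "opext C B \<xi> = {X. is_extension C B X \<and>
     (\<forall>e \<in> carrier (egrp X). \<forall>b \<in> carrier B.
        incl X (\<xi> (proj X e) b) = e \<otimes>\<^bsub>egrp X\<^esub> incl X b \<otimes>\<^bsub>egrp X\<^esub> inv\<^bsub>egrp X\<^esub> e)}"

definition ext_hom ::
    "'b monoid \<Rightarrow> ('b, 'c, 'e) extn \<Rightarrow> ('b, 'c, 'e) extn \<Rightarrow> ('e \<Rightarrow> 'e) set" where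
  "ext_hom B X Y = {\<sigma> \<in> ehom (egrp X) (egrp Y).
     (\<forall>b \<in> carrier B. \<sigma> (incl X b) = incl Y b) \<and>
     (\<forall>e \<in> carrier (egrp X). proj Y (\<sigma> e) = proj X e)}"

text \<open>
  \<open>(Y, q)\<close> is a pushforward of the extension \<open>X\<close> of \<open>C\<close> by \<open>A\<close> along \<open>f : A \<rightarrow> B\<close>:
  an extension \<open>Y\<close> of \<open>C\<close> by \<open>B\<close> together with a morphism of extensions \<open>(f, q, id) : X \<rightarrow> Y\<close>.
  These data determine \<open>(Y, q)\<close> up to a unique isomorphism.
\<close>

definition is_pushforward ::
    "'c monoid \<Rightarrow> 'a monoid \<Rightarrow> ('a, 'c, 'd) extn \<Rightarrow> ('a \<Rightarrow> 'b) \<Rightarrow> 'b monoid \<Rightarrow>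
     ('b, 'c, 'e) extn \<Rightarrow> ('d \<Rightarrow> 'e) \<Rightarrow> bool" where
  "is_pushforward C A X f B Y q \<longleftrightarrow>
     is_extension C A X \<and> f \<in> hom A B \<and> is_extension C B Y \<and> q \<in> ehom (egrp X) (egrp Y) \<and>
     (\<forall>a \<in> carrier A. q (incl X a) = incl Y (f a)) \<and>
     (\<forall>x \<in> carrier (egrp X). proj Y (q x) = proj X x)"

definition fibre_product ::
    "'b monoid \<Rightarrow> ('b, 'c, 'e) extn \<Rightarrow> ('b, 'c, 'e) extn \<Rightarrow> ('b \<times> 'b, 'c, 'e \<times> 'e) extn" where
  "fibre_product B X Y =
     (let P = pullback_group (egrp X) (egrp Y) (proj X) (proj Y) in
      \<lparr>egrp = P,
       incl = (\<lambda>(b, b') \<in> carrier (B \<times>\<times> B). (incl X b, incl Y b')),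
       proj = (\<lambda>(e, e') \<in> carrier P. proj X e)\<rparr>)"

text \<open>
  A choice of Baer sums assigns to two extensions \<open>X\<close>, \<open>Y\<close> an extension together with the map
  from the fibre product of \<open>X\<close> and \<open>Y\<close> that exhibits it as a pushforward along the codiagonal.
\<close>

type_synonym ('b, 'c, 'e) baer_choice =
  "('b, 'c, 'e) extn \<Rightarrow> ('b, 'c, 'e) extn \<Rightarrow> ('b, 'c, 'e) extn \<times> ('e \<times> 'e \<Rightarrow> 'e)"

definition is_baer_choice ::
    "'c monoid \<Rightarrow> 'b monoid \<Rightarrow> ('c \<Rightarrow> 'b \<Rightarrow> 'b) \<Rightarrow> ('b, 'c, 'e) baer_choice \<Rightarrow> bool" where
  "is_baer_choice C B \<xi> P \<longleftrightarrow> (\<forall>X \<in> opext C B \<xi>. \<forall>Y \<in> opext C B \<xi>.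
     fst (P X Y) \<in> opext C B \<xi> \<and>
     is_pushforward C (B \<times>\<times> B) (fibre_product B X Y) (\<lambda>(b, b'). b \<otimes>\<^bsub>B\<^esub> b') B
       (fst (P X Y)) (snd (P X Y)))"

text \<open>
  All middle groups have their elements in one type \<open>'e\<close>, which plays the role of a universe; an
  injection \<open>\<iota>\<close> of \<open>carrier B \<times> carrier C\<close> into \<open>'e\<close> transports the semidirect product there.
\<close>

definition split_ext ::
    "'c monoid \<Rightarrow> 'b monoid \<Rightarrow> ('c \<Rightarrow> 'b \<Rightarrow> 'b) \<Rightarrow> ('b \<times> 'c \<Rightarrow> 'e) \<Rightarrow> ('b, 'c, 'e) extn" where
  "split_ext C B \<xi> \<iota> =
     \<lparr>egrp = image_group \<iota> (semidirect C B \<xi>),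
      incl = (\<lambda>b \<in> carrier B. \<iota> (b, \<one>\<^bsub>C\<^esub>)),
      proj = (\<lambda>x \<in> \<iota> ` (carrier B \<times> carrier C).
                snd (inv_into (carrier B \<times> carrier C) \<iota> x))\<rparr>"

text \<open>
  The structural isomorphisms are those induced by
  \<open>((e, e'), e'') \<mapsto> (e, (e', e''))\<close>, \<open>((b, c), e) \<mapsto> \<kappa> b \<otimes> e\<close>, \<open>(e, (b, c)) \<mapsto> \<kappa> b \<otimes> e\<close> and
  \<open>(e, e') \<mapsto> (e', e)\<close>, where \<open>e\<close> lies over \<open>c\<close> in the second and the third.
\<close>

definition H2 ::
    "'c monoid \<Rightarrow> 'b monoid \<Rightarrow> ('c \<Rightarrow> 'b \<Rightarrow> 'b) \<Rightarrow> ('b \<times> 'c \<Rightarrow> 'e) \<Rightarrow> ('b, 'c, 'e) baer_choice \<Rightarrow>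
     (('b, 'c, 'e) extn, 'e \<Rightarrow> 'e) smcat" where
  "H2 C B \<xi> \<iota> P =
     (let bsum = (\<lambda>X Y. fst (P X Y));
          q = (\<lambda>X Y. snd (P X Y));
          U = split_ext C B \<xi> \<iota>;
          fib = (\<lambda>X Y. carrier (egrp (fibre_product B X Y)));
          B_part = (\<lambda>x. fst (inv_into (carrier B \<times> carrier C) \<iota> x))
      in
      \<lparr>objs = opext C B \<xi>,
       homs = ext_hom B,
       idn = (\<lambda>X. \<lambda>e \<in> carrier (egrp X). e),
       cmp = (\<lambda>X Y Z \<tau> \<sigma>. compose (carrier (egrp X)) \<tau> \<sigma>),
       tens = bsum,
       tunit = U,
       tarr = (\<lambda>X X' Y Y' \<sigma> \<tau>.
         induced (fib X Y) (egrp (bsum X Y)) (q X Y) (\<lambda>(e, e'). q X' Y' (\<sigma> e, \<tau> e'))),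
       assc = (\<lambda>X Y Z.
         induced {((e, e'), e''). e \<in> carrier (egrp X) \<and> e' \<in> carrier (egrp Y) \<and>
                    e'' \<in> carrier (egrp Z) \<and> proj X e = proj Y e' \<and> proj Y e' = proj Z e''}
           (egrp (bsum (bsum X Y) Z))
           (\<lambda>((e, e'), e''). q (bsum X Y) Z (q X Y (e, e'), e''))
           (\<lambda>((e, e'), e''). q X (bsum Y Z) (e, q Y Z (e', e'')))),
       lun = (\<lambda>X. induced (fib U X) (egrp (bsum U X)) (q U X)
         (\<lambda>(x, e). incl X (B_part x) \<otimes>\<^bsub>egrp X\<^esub> e)),
       run = (\<lambda>X. induced (fib X U) (egrp (bsum X U)) (q X U)
         (\<lambda>(e, x). incl X (B_part x) \<otimes>\<^bsub>egrp X\<^esub> e)),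
       symm = (\<lambda>X Y. induced (fib X Y) (egrp (bsum X Y)) (q X Y) (\<lambda>(e, e'). q Y X (e', e)))\<rparr>)"


section \<open>Crossed modules and butterflies\<close>

record ('h, 'g) xmod =
  top_grp :: "'h monoid"
  base_grp :: "'g monoid"
  bdry :: "'h \<Rightarrow> 'g"
  xact :: "'g \<Rightarrow> 'h \<Rightarrow> 'h"

definition crossed_module :: "('h, 'g) xmod \<Rightarrow> bool" where
  "crossed_module X \<longleftrightarrow> group (top_grp X) \<and> group (base_grp X) \<and>
     bdry X \<in> ehom (top_grp X) (base_grp X) \<and>
     xact X \<in> hom (base_grp X) (AutoGroup (top_grp X)) \<and>
     (\<forall>g \<in> carrier (base_grp X). \<forall>h \<in> carrier (top_grp X).
        bdry X (xact X g h) = g \<otimes>\<^bsub>base_grp X\<^esub> bdry X h \<otimes>\<^bsub>base_grp X\<^esub> inv\<^bsub>base_grp X\<^esub> g) \<and>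
     (\<forall>h \<in> carrier (top_grp X). \<forall>h' \<in> carrier (top_grp X).
        xact X (bdry X h) h' = h \<otimes>\<^bsub>top_grp X\<^esub> h' \<otimes>\<^bsub>top_grp X\<^esub> inv\<^bsub>top_grp X\<^esub> h)"

text \<open>
  The crossed extension with middle part \<open>0 : B \<rightarrow> C\<close> and identities as outer maps \<open>B \<rightarrow> B\<close> and
  \<open>C \<rightarrow> C\<close>; only the crossed module enters into the notion of a butterfly.
\<close>

definition I_xmod :: "'c monoid \<Rightarrow> 'b monoid \<Rightarrow> ('c \<Rightarrow> 'b \<Rightarrow> 'b) \<Rightarrow> ('b, 'c) xmod" where
  "I_xmod C B \<xi> = \<lparr>top_grp = B, base_grp = C, bdry = (\<lambda>b \<in> carrier B. \<one>\<^bsub>C\<^esub>), xact = \<xi>\<rparr>"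

text \<open>
  The four maps of a butterfly from \<open>X\<close> to \<open>Y\<close>: \<open>dom_in\<close>, \<open>cod_in\<close> start at the top groups and
  \<open>dom_out\<close>, \<open>cod_out\<close> end at the base groups of the domain \<open>X\<close> and the codomain \<open>Y\<close>.
\<close>

record ('h, 'g, 'k, 'l, 'e) bfly =
  bgrp :: "'e monoid"
  dom_in :: "'h \<Rightarrow> 'e"
  cod_in :: "'k \<Rightarrow> 'e"
  dom_out :: "'e \<Rightarrow> 'g"
  cod_out :: "'e \<Rightarrow> 'l"

definition butterfly ::
    "('h, 'g) xmod \<Rightarrow> ('k, 'l) xmod \<Rightarrow> ('h, 'g, 'k, 'l, 'e) bfly \<Rightarrow> bool" where
  "butterfly X Y E \<longleftrightarrow>
     crossed_module X \<and> crossed_module Y \<and> group (bgrp E) \<and>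
     dom_in E \<in> ehom (top_grp X) (bgrp E) \<and> cod_in E \<in> ehom (top_grp Y) (bgrp E) \<and>
     dom_out E \<in> ehom (bgrp E) (base_grp X) \<and> cod_out E \<in> ehom (bgrp E) (base_grp Y) \<and>
     (\<forall>h \<in> carrier (top_grp X). dom_out E (dom_in E h) = bdry X h) \<and>
     (\<forall>k \<in> carrier (top_grp Y). cod_out E (cod_in E k) = bdry Y k) \<and>
     (\<forall>h \<in> carrier (top_grp X). cod_out E (dom_in E h) = \<one>\<^bsub>base_grp Y\<^esub>) \<and>
     inj_on (cod_in E) (carrier (top_grp Y)) \<and>
     dom_out E ` carrier (bgrp E) = carrier (base_grp X) \<and>
     kernel (bgrp E) (base_grp X) (dom_out E) = cod_in E ` carrier (top_grp Y) \<and>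
     (\<forall>e \<in> carrier (bgrp E). \<forall>h \<in> carrier (top_grp X).
        dom_in E (xact X (dom_out E e) h) = e \<otimes>\<^bsub>bgrp E\<^esub> dom_in E h \<otimes>\<^bsub>bgrp E\<^esub> inv\<^bsub>bgrp E\<^esub> e) \<and>
     (\<forall>e \<in> carrier (bgrp E). \<forall>k \<in> carrier (top_grp Y).
        cod_in E (xact Y (cod_out E e) k) = e \<otimes>\<^bsub>bgrp E\<^esub> cod_in E k \<otimes>\<^bsub>bgrp E\<^esub> inv\<^bsub>bgrp E\<^esub> e)"

text \<open>
  Butterflies \<open>E : X \<rightarrow> Y\<close> and \<open>F : Y \<rightarrow> Z\<close> are composed by means of a cokernel
  \<open>q : bfly_pullback E F \<rightarrow> Q\<close> of \<open>k \<mapsto> (cod_in E k, dom_in F k)\<close>.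
\<close>

definition bfly_pullback ::
    "('h, 'g, 'k, 'l, 'e) bfly \<Rightarrow> ('k, 'l, 'm, 'n, 'f) bfly \<Rightarrow> ('e \<times> 'f) monoid" where
  "bfly_pullback E F = pullback_group (bgrp E) (bgrp F) (cod_out E) (dom_out F)"

definition bfly_cokernel ::
    "('k, 'l) xmod \<Rightarrow> ('h, 'g, 'k, 'l, 'e) bfly \<Rightarrow> ('k, 'l, 'm, 'n, 'f) bfly \<Rightarrow>
     'q monoid \<Rightarrow> ('e \<times> 'f \<Rightarrow> 'q) \<Rightarrow> bool" where
  "bfly_cokernel Y E F Q q \<longleftrightarrow>
     is_cokernel (top_grp Y) (bfly_pullback E F) (\<lambda>k. (cod_in E k, dom_in F k)) Q q"

definition bfly_comp ::
    "('h, 'g) xmod \<Rightarrow> ('m, 'n) xmod \<Rightarrow> 'q monoid \<times> ('e \<times> 'f \<Rightarrow> 'q) \<Rightarrow>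
     ('k, 'l, 'm, 'n, 'f) bfly \<Rightarrow> ('h, 'g, 'k, 'l, 'e) bfly \<Rightarrow> ('h, 'g, 'm, 'n, 'q) bfly" where
  "bfly_comp X Z Qq F E = (case Qq of (Q, q) \<Rightarrow>
     \<lparr>bgrp = Q,
      dom_in = (\<lambda>h \<in> carrier (top_grp X). q (dom_in E h, \<one>\<^bsub>bgrp F\<^esub>)),
      cod_in = (\<lambda>m \<in> carrier (top_grp Z). q (\<one>\<^bsub>bgrp E\<^esub>, cod_in F m)),
      dom_out = induced (carrier (bfly_pullback E F)) Q q (\<lambda>(e, f). dom_out E e),
      cod_out = induced (carrier (bfly_pullback E F)) Q q (\<lambda>(e, f). cod_out F f)\<rparr>)"


section \<open>The symmetric 2-group of butterflies\<close>

type_synonym ('b, 'c, 'e) endo_bfly = "('b, 'c, 'b, 'c, 'e) bfly"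

definition Eq_objs ::
    "'c monoid \<Rightarrow> 'b monoid \<Rightarrow> ('c \<Rightarrow> 'b \<Rightarrow> 'b) \<Rightarrow> ('b, 'c, 'e) endo_bfly set" where
  "Eq_objs C B \<xi> = {E. butterfly (I_xmod C B \<xi>) (I_xmod C B \<xi>) E \<and>
     dom_in E = (\<lambda>b \<in> carrier B. inv\<^bsub>bgrp E\<^esub> (cod_in E b)) \<and> cod_out E = dom_out E}"

definition Eq_hom ::
    "'b monoid \<Rightarrow> ('b, 'c, 'e) endo_bfly \<Rightarrow> ('b, 'c, 'e) endo_bfly \<Rightarrow> ('e \<Rightarrow> 'e) set" where
  "Eq_hom B E F = {\<sigma> \<in> iso (bgrp E) (bgrp F) \<inter> extensional (carrier (bgrp E)).
     (\<forall>b \<in> carrier B. \<sigma> (cod_in E b) = cod_in F b) \<and>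
     (\<forall>e \<in> carrier (bgrp E). dom_out F (\<sigma> e) = dom_out E e)}"

text \<open>
  A choice of cokernels assigns \<open>(Q, q)\<close> to \<open>E\<close> and \<open>F\<close>, in this order, for the composite
  \<open>F \<cdot> E\<close>.
\<close>

type_synonym ('b, 'c, 'e) coker_choice =
  "('b, 'c, 'e) endo_bfly \<Rightarrow> ('b, 'c, 'e) endo_bfly \<Rightarrow> 'e monoid \<times> ('e \<times> 'e \<Rightarrow> 'e)"

definition is_coker_choice ::
    "'c monoid \<Rightarrow> 'b monoid \<Rightarrow> ('c \<Rightarrow> 'b \<Rightarrow> 'b) \<Rightarrow> ('b, 'c, 'e) coker_choice \<Rightarrow> bool" where
  "is_coker_choice C B \<xi> K \<longleftrightarrow> (\<forall>E \<in> Eq_objs C B \<xi>. \<forall>F \<in> Eq_objs C B \<xi>.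
     bfly_cokernel (I_xmod C B \<xi>) E F (fst (K E F)) (snd (K E F)))"

definition id_bfly ::
    "'c monoid \<Rightarrow> 'b monoid \<Rightarrow> ('c \<Rightarrow> 'b \<Rightarrow> 'b) \<Rightarrow> ('b \<times> 'c \<Rightarrow> 'e) \<Rightarrow> ('b, 'c, 'e) endo_bfly" where
  "id_bfly C B \<xi> \<iota> =
     (let G = image_group \<iota> (semidirect C B \<xi>);
          i_B = (\<lambda>b \<in> carrier B. \<iota> (b, \<one>\<^bsub>C\<^esub>));
          p_C = (\<lambda>x \<in> \<iota> ` (carrier B \<times> carrier C).
                   snd (inv_into (carrier B \<times> carrier C) \<iota> x))
      in
      \<lparr>bgrp = G,
       dom_in = (\<lambda>b \<in> carrier B. inv\<^bsub>G\<^esub> (i_B b)),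
       cod_in = i_B,
       dom_out = p_C,
       cod_out = p_C\<rparr>)"

text \<open>
  The tensor product of \<open>E\<close> and \<open>F\<close> is the composite \<open>F \<cdot> E\<close>. The unit constraints are the
  canonical isomorphisms \<open>E \<cdot> 1 \<cong> E\<close> and \<open>1 \<cdot> E \<cong> E\<close>.
\<close>

definition EqI ::
    "'c monoid \<Rightarrow> 'b monoid \<Rightarrow> ('c \<Rightarrow> 'b \<Rightarrow> 'b) \<Rightarrow> ('b \<times> 'c \<Rightarrow> 'e) \<Rightarrow> ('b, 'c, 'e) coker_choice \<Rightarrow>
     (('b, 'c, 'e) endo_bfly, 'e \<Rightarrow> 'e) smcat" where
  "EqI C B \<xi> \<iota> K =
     (let I = I_xmod C B \<xi>;
          ten = (\<lambda>E F. bfly_comp I I (K E F) F E);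
          q = (\<lambda>E F. snd (K E F));
          U = id_bfly C B \<xi> \<iota>;
          fib = (\<lambda>E F. carrier (bfly_pullback E F));
          B_part = (\<lambda>x. fst (inv_into (carrier B \<times> carrier C) \<iota> x))
      in
      \<lparr>objs = Eq_objs C B \<xi>,
       homs = Eq_hom B,
       idn = (\<lambda>E. \<lambda>e \<in> carrier (bgrp E). e),
       cmp = (\<lambda>E F G \<tau> \<sigma>. compose (carrier (bgrp E)) \<tau> \<sigma>),
       tens = ten,
       tunit = U,
       tarr = (\<lambda>E E' F F' \<sigma> \<tau>.
         induced (fib E F) (bgrp (ten E F)) (q E F) (\<lambda>(e, f). q E' F' (\<sigma> e, \<tau> f))),
       assc = (\<lambda>E F G.
         induced {((e, f), g). e \<in> carrier (bgrp E) \<and> f \<in> carrier (bgrp F) \<and>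
                    g \<in> carrier (bgrp G) \<and> cod_out E e = dom_out F f \<and> cod_out F f = dom_out G g}
           (bgrp (ten (ten E F) G))
           (\<lambda>((e, f), g). q (ten E F) G (q E F (e, f), g))
           (\<lambda>((e, f), g). q E (ten F G) (e, q F G (f, g)))),
       lun = (\<lambda>E. induced (fib U E) (bgrp (ten U E)) (q U E)
         (\<lambda>(x, e). cod_in E (B_part x) \<otimes>\<^bsub>bgrp E\<^esub> e)),
       run = (\<lambda>E. induced (fib E U) (bgrp (ten E U)) (q E U)
         (\<lambda>(e, x). cod_in E (B_part x) \<otimes>\<^bsub>bgrp E\<^esub> e)),
       symm = (\<lambda>E F. induced (fib E F) (bgrp (ten E F)) (q E F) (\<lambda>(e, f). q F E (f, e)))\<rparr>)"


section \<open>The comparison\<close>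

definition Phi_obj :: "'b monoid \<Rightarrow> ('b, 'c, 'e) extn \<Rightarrow> ('b, 'c, 'e) endo_bfly" where
  "Phi_obj B X =
     \<lparr>bgrp = egrp X,
      dom_in = (\<lambda>b \<in> carrier B. inv\<^bsub>egrp X\<^esub> (incl X b)),
      cod_in = incl X,
      dom_out = proj X,
      cod_out = proj X\<rparr>"

definition Phi_arr ::
    "('b, 'c, 'e) extn \<Rightarrow> ('b, 'c, 'e) extn \<Rightarrow> ('e \<Rightarrow> 'e) \<Rightarrow> ('e \<Rightarrow> 'e)" where
  "Phi_arr X Y \<sigma> = \<sigma>"

text \<open>
  Compatibility: the pushforward chosen for \<open>X\<close> and \<open>Y\<close> has the same underlying group and the
  same map from the pullback as the cokernel chosen for the corresponding butterflies.
\<close>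

definition compatible_choices ::
    "'c monoid \<Rightarrow> 'b monoid \<Rightarrow> ('c \<Rightarrow> 'b \<Rightarrow> 'b) \<Rightarrow>
     ('b, 'c, 'e) baer_choice \<Rightarrow> ('b, 'c, 'e) coker_choice \<Rightarrow> bool" where
  "compatible_choices C B \<xi> P K \<longleftrightarrow>
     is_baer_choice C B \<xi> P \<and> is_coker_choice C B \<xi> K \<and>
     (\<forall>X \<in> opext C B \<xi>. \<forall>Y \<in> opext C B \<xi>.
        K (Phi_obj B X) (Phi_obj B Y) = (egrp (fst (P X Y)), snd (P X Y)))"

end

theory Submission
  imports Defs
begin

text \<open>
  An extension \<open>B \<rightarrow> E \<rightarrow> C\<close> and the butterfly \<open>(E, -\<kappa>, \<kappa>, \<gamma>, \<gamma>)\<close> consist of the same data, subject to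
  the same conditions, and by the short five lemma (\<open>ext_hom_bij\<close>) morphisms of extensions are the
  isomorphisms that are the arrows between the corresponding butterflies. So \<open>\<Phi>\<close> is an isomorphism
  of groupoids. It also respects the tensor products: the Baer sum of \<open>E\<close> and \<open>E'\<close> pushes \<open>E \<times>\<^sub>C E'\<close>
  forward along the codiagonal of \<open>B\<close>, the composite of butterflies divides \<open>E \<times>\<^sub>C E'\<close> by the image
  of \<open>b \<mapsto> (\<kappa> b, - \<kappa>' b)\<close>, and the kernel of the codiagonal is precisely this antidiagonal copy of \<open>B\<close>
  (\<open>q_cokernel\<close>, \<open>bfly_comp_Phi_obj\<close>). For compatible choices the two symmetric monoidal structures
  therefore coincide under \<open>\<Phi>\<close> (\<open>Phi_arrow_preserving_strict\<close>), and the axioms of a symmetric 2-group need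
  to be proved on one side only; \<open>symmetric_two_group_image\<close> carries them over to the other.

  They are proved for extensions. An extension is treated as a group over \<open>C\<close> on which \<open>B\<close> acts freely,
  transitively along the fibres, by translations. From the mere fact that \<open>q\<close> from \<open>E \<times>\<^sub>C E'\<close> to the
  Baer sum is a morphism of extensions over the codiagonal it follows that \<open>q\<close> is surjective, that
  translations of either argument become translations of the value, and that the fibres of \<open>q\<close> are
  the orbits of the antidiagonal (\<open>q_cases\<close>, \<open>q_act\<close>, \<open>q_eq_cases\<close>). Hence the Baer sum behaves like a
  tensor product over \<open>B\<close>: arrows out of it are balanced multiplicative maps of pairs
  (\<open>bsum_universal\<close>) and are determined by their values on \<open>q\<close>. Each structural arrow has an explicit
  value there, and the coherence laws become equalities of such values. The inverse of an
  extension is the same group with the action of \<open>B\<close> inverted (\<open>opposite_inverse\<close>).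

  That compatible choices exist is a separate point, since the middle groups have to live in one
  fixed type: the Baer sum of \<open>X\<close> and \<open>Y\<close> can be realised on the carrier of \<open>X\<close>
  (\<open>baer_sum_exists\<close>).
\<close>

section \<open>Maps induced through a surjection\<close>

lemma induced_eqI:
  assumes "p ` D = carrier Q" "h \<in> extensional (carrier Q)" "\<And>x. x \<in> D \<Longrightarrow> h (p x) = f x"
  shows "induced D Q p f = h"
  unfolding induced_def
proof (rule the_equality)
  fix h' assume h': "h' \<in> extensional (carrier Q) \<and> (\<forall>x \<in> D. h' (p x) = f x)"
  show "h' = h"
  proof (rule extensionalityI)
    fix y assume "y \<in> carrier Q"
    with assms(1) obtain x where "x \<in> D" "y = p x" by blast
    with h' assms(3) show "h' y = h y" by simp
  qed (use h' assms(2) in auto)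
qed (use assms in auto)

text \<open>
  The map \<open>induced\<close> is a definite description; the choice of a preimage of every point of \<open>Q\<close>
  gives a witness, and surjectivity of \<open>p\<close> makes it the only one.
\<close>

lemma induced_well_defined:
  assumes surj: "p ` D = carrier Q"
    and fibres: "\<And>x y. \<lbrakk>x \<in> D; y \<in> D; p x = p y\<rbrakk> \<Longrightarrow> f x = f y"
  shows "induced D Q p f \<in> extensional (carrier Q)"
    and "x \<in> D \<Longrightarrow> induced D Q p f (p x) = f x"
proof -
  let ?h = "\<lambda>y \<in> carrier Q. f (SOME x. x \<in> D \<and> p x = y)"
  have h: "?h (p x) = f x" if x: "x \<in> D" for x
  proof -
    define z where "z = (SOME x'. x' \<in> D \<and> p x' = p x)"
    have z: "z \<in> D \<and> p z = p x"
      unfolding z_def by (rule someI[of _ x]) (use x in simp)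
    have "?h (p x) = f z" using x surj unfolding z_def by auto
    also have "\<dots> = f x" by (rule fibres) (use z x in auto)
    finally show ?thesis .
  qed
  have eq: "induced D Q p f = ?h"
    by (rule induced_eqI) (use surj h in auto)
  show "induced D Q p f \<in> extensional (carrier Q)" unfolding eq by simp
  show "x \<in> D \<Longrightarrow> induced D Q p f (p x) = f x" unfolding eq by (rule h)
qed

section \<open>Extensions as groups with a free fibrewise action\<close>

text \<open>
  Left translation by the kernel. Exactness says that it is a free action of \<open>B\<close> on the middle group
  whose orbits are the fibres of the projection to \<open>C\<close>, and the module structure \<open>\<xi>\<close> is the rule for
  moving \<open>B\<close> past an element of the group (\<open>act_mult_right\<close>). In these terms the homomorphism
  conditions on arrows, the Baer sum and all structural isomorphisms have uniform descriptions.
\<close>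

definition act :: "('b, 'c, 'e) extn \<Rightarrow> 'b \<Rightarrow> 'e \<Rightarrow> 'e" where
  "act X b e = incl X b \<otimes>\<^bsub>egrp X\<^esub> e"

locale module_extensions =
  fixes C :: "'c monoid" and B :: "'b monoid" and \<xi> :: "'c \<Rightarrow> 'b \<Rightarrow> 'b"
  assumes module: "group_module C B \<xi>"
begin

sublocale C: group C using module by (simp add: group_module_def)
sublocale B: comm_group B using module by (simp add: group_module_def)

lemma xi_auto: "c \<in> carrier C \<Longrightarrow> \<xi> c \<in> auto B"
  using module by (auto simp: group_module_def hom_def AutoGroup_def)

lemma xi_closed [simp]: "\<lbrakk>c \<in> carrier C; b \<in> carrier B\<rbrakk> \<Longrightarrow> \<xi> c b \<in> carrier B"
  using xi_auto[of c] by (auto simp: auto_def hom_def)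

lemma xi_mult: "\<lbrakk>c \<in> carrier C; b \<in> carrier B; b' \<in> carrier B\<rbrakk>
    \<Longrightarrow> \<xi> c (b \<otimes>\<^bsub>B\<^esub> b') = \<xi> c b \<otimes>\<^bsub>B\<^esub> \<xi> c b'"
  using xi_auto[of c] by (auto simp: auto_def hom_def)

lemma xi_comp: "\<lbrakk>c \<in> carrier C; c' \<in> carrier C; b \<in> carrier B\<rbrakk>
    \<Longrightarrow> \<xi> (c \<otimes>\<^bsub>C\<^esub> c') b = \<xi> c (\<xi> c' b)"
  using module xi_auto[of c] xi_auto[of c']
  by (auto simp: group_module_def hom_def AutoGroup_def BijGroup_def auto_def compose_def)

text \<open>
  An idempotent injective map is the identity.
\<close>

lemma xi_one [simp]: "b \<in> carrier B \<Longrightarrow> \<xi> \<one>\<^bsub>C\<^esub> b = b"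
proof -
  assume b: "b \<in> carrier B"
  have "\<xi> \<one>\<^bsub>C\<^esub> (\<xi> \<one>\<^bsub>C\<^esub> b) = \<xi> \<one>\<^bsub>C\<^esub> b"
    using xi_comp[of "\<one>\<^bsub>C\<^esub>" "\<one>\<^bsub>C\<^esub>" b] b by simp
  moreover have "inj_on (\<xi> \<one>\<^bsub>C\<^esub>) (carrier B)"
    using xi_auto[of "\<one>\<^bsub>C\<^esub>"] by (auto simp: auto_def Bij_def bij_betw_def)
  ultimately show ?thesis using b by (auto dest: inj_onD)
qed

lemma xi_unit: "c \<in> carrier C \<Longrightarrow> \<xi> c \<one>\<^bsub>B\<^esub> = \<one>\<^bsub>B\<^esub>"
  using xi_mult[of c "\<one>\<^bsub>B\<^esub>" "\<one>\<^bsub>B\<^esub>"] B.l_cancel_one[of "\<xi> c \<one>\<^bsub>B\<^esub>" "\<xi> c \<one>\<^bsub>B\<^esub>"] by simp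

lemma xi_inv: "\<lbrakk>c \<in> carrier C; b \<in> carrier B\<rbrakk> \<Longrightarrow> \<xi> c (inv\<^bsub>B\<^esub> b) = inv\<^bsub>B\<^esub> (\<xi> c b)"
  using xi_mult[of c "inv\<^bsub>B\<^esub> b" b] xi_unit[of c]
  by (intro B.inv_equality[symmetric]) simp_all

abbreviation Obj :: "('b, 'c, 'e) extn set" where "Obj \<equiv> opext C B \<xi>"
abbreviation carr :: "('b, 'c, 'e) extn \<Rightarrow> 'e set" where "carr X \<equiv> carrier (egrp X)"

lemma opextD:
  assumes "X \<in> Obj"
  shows "group (egrp X)" "incl X \<in> hom B (egrp X)" "incl X \<in> extensional (carrier B)"
    "inj_on (incl X) (carrier B)" "proj X \<in> hom (egrp X) C" "proj X \<in> extensional (carr X)"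
    "proj X ` carr X = carrier C" "kernel (egrp X) C (proj X) = incl X ` carrier B"
    "\<lbrakk>e \<in> carr X; b \<in> carrier B\<rbrakk> \<Longrightarrow>
       incl X (\<xi> (proj X e) b) = e \<otimes>\<^bsub>egrp X\<^esub> incl X b \<otimes>\<^bsub>egrp X\<^esub> inv\<^bsub>egrp X\<^esub> e"
  using assms by (auto simp: opext_def is_extension_def ehom_def)

lemma mult_closed [simp]:
  "\<lbrakk>X \<in> Obj; e \<in> carr X; e' \<in> carr X\<rbrakk> \<Longrightarrow> e \<otimes>\<^bsub>egrp X\<^esub> e' \<in> carr X"
  using opextD(1) by (metis group.is_monoid monoid.m_closed)

lemma one_closed [simp]: "X \<in> Obj \<Longrightarrow> \<one>\<^bsub>egrp X\<^esub> \<in> carr X"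
  using opextD(1) by (metis group.is_monoid monoid.one_closed)

lemma incl_closed [simp]: "\<lbrakk>X \<in> Obj; b \<in> carrier B\<rbrakk> \<Longrightarrow> incl X b \<in> carr X"
  using opextD(2)[of X] by (auto simp: hom_def)

lemma proj_closed [simp]: "\<lbrakk>X \<in> Obj; e \<in> carr X\<rbrakk> \<Longrightarrow> proj X e \<in> carrier C"
  using opextD(5)[of X] by (auto simp: hom_def)

lemma proj_mult [simp]: "\<lbrakk>X \<in> Obj; e \<in> carr X; e' \<in> carr X\<rbrakk>
    \<Longrightarrow> proj X (e \<otimes>\<^bsub>egrp X\<^esub> e') = proj X e \<otimes>\<^bsub>C\<^esub> proj X e'"
  using opextD(5)[of X] by (auto simp: hom_def)

lemma proj_one [simp]: "X \<in> Obj \<Longrightarrow> proj X \<one>\<^bsub>egrp X\<^esub> = \<one>\<^bsub>C\<^esub>"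
  using opextD(1,5)[of X] hom_one C.group_axioms by blast

lemma proj_incl [simp]: "\<lbrakk>X \<in> Obj; b \<in> carrier B\<rbrakk> \<Longrightarrow> proj X (incl X b) = \<one>\<^bsub>C\<^esub>"
  using opextD(8)[of X] by (auto simp: kernel_def)

lemma fibre_nonempty: "\<lbrakk>X \<in> Obj; c \<in> carrier C\<rbrakk> \<Longrightarrow> \<exists>e \<in> carr X. proj X e = c"
  using opextD(7)[of X] by (metis imageE)

lemma act_closed [simp]: "\<lbrakk>X \<in> Obj; b \<in> carrier B; e \<in> carr X\<rbrakk> \<Longrightarrow> act X b e \<in> carr X"
  by (simp add: act_def)

lemma proj_act [simp]: "\<lbrakk>X \<in> Obj; b \<in> carrier B; e \<in> carr X\<rbrakk> \<Longrightarrow> proj X (act X b e) = proj X e"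
  by (simp add: act_def)

lemma act_one [simp]: "\<lbrakk>X \<in> Obj; e \<in> carr X\<rbrakk> \<Longrightarrow> act X \<one>\<^bsub>B\<^esub> e = e"
  using hom_one[OF opextD(2)[of X] B.group_axioms opextD(1)[of X]] opextD(1)[of X]
  by (simp add: act_def group.is_monoid)

lemma act_act [simp]: "\<lbrakk>X \<in> Obj; b \<in> carrier B; b' \<in> carrier B; e \<in> carr X\<rbrakk>
    \<Longrightarrow> act X b (act X b' e) = act X (b \<otimes>\<^bsub>B\<^esub> b') e"
  using opextD(2)[of X] opextD(1)[of X]
  by (simp add: act_def hom_mult monoid.m_assoc group.is_monoid)

lemma incl_eq_act: "\<lbrakk>X \<in> Obj; b \<in> carrier B\<rbrakk> \<Longrightarrow> incl X b = act X b \<one>\<^bsub>egrp X\<^esub>"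
  using opextD(1)[of X] by (simp add: act_def group.is_monoid)

lemma act_mult_left: "\<lbrakk>X \<in> Obj; b \<in> carrier B; e \<in> carr X; e' \<in> carr X\<rbrakk>
    \<Longrightarrow> act X b e \<otimes>\<^bsub>egrp X\<^esub> e' = act X b (e \<otimes>\<^bsub>egrp X\<^esub> e')"
  using opextD(1)[of X] by (simp add: act_def monoid.m_assoc group.is_monoid)

lemma act_mult_right:
  assumes X: "X \<in> Obj" and b: "b \<in> carrier B" and e: "e \<in> carr X" "e' \<in> carr X"
  shows "e \<otimes>\<^bsub>egrp X\<^esub> act X b e' = act X (\<xi> (proj X e) b) (e \<otimes>\<^bsub>egrp X\<^esub> e')"
proof -
  interpret G: group "egrp X" by (rule opextD(1)[OF X])
  have "inv\<^bsub>egrp X\<^esub> e \<otimes>\<^bsub>egrp X\<^esub> (e \<otimes>\<^bsub>egrp X\<^esub> e') = e'"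
    using e by (simp add: G.m_assoc[symmetric])
  then show ?thesis
    using X b e by (simp add: act_def opextD(9) G.m_assoc)
qed

lemma act_mult:
  assumes "X \<in> Obj" "b \<in> carrier B" "b' \<in> carrier B" "e \<in> carr X" "e' \<in> carr X"
  shows "act X b e \<otimes>\<^bsub>egrp X\<^esub> act X b' e' =
    act X (b \<otimes>\<^bsub>B\<^esub> \<xi> (proj X e) b') (e \<otimes>\<^bsub>egrp X\<^esub> e')"
  using assms by (simp add: act_mult_left act_mult_right B.m_comm)

lemma act_free:
  assumes X: "X \<in> Obj" and "b \<in> carrier B" "b' \<in> carrier B" "e \<in> carr X"
    and eq: "act X b e = act X b' e"
  shows "b = b'"
proof -
  interpret G: group "egrp X" by (rule opextD(1)[OF X])
  have "incl X b = incl X b'" using assms by (simp add: act_def)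
  with assms show ?thesis by (auto dest: inj_onD[OF opextD(4)[OF X]])
qed

lemma act_fixed: "\<lbrakk>X \<in> Obj; b \<in> carrier B; e \<in> carr X; act X b e = e\<rbrakk> \<Longrightarrow> b = \<one>\<^bsub>B\<^esub>"
  using act_free[of X b "\<one>\<^bsub>B\<^esub>" e] by simp

lemma act_transitive:
  assumes X: "X \<in> Obj" and e: "e \<in> carr X" "e' \<in> carr X" and eq: "proj X e = proj X e'"
  obtains b where "b \<in> carrier B" "e' = act X b e"
proof -
  interpret G: group "egrp X" by (rule opextD(1)[OF X])
  interpret p: group_hom "egrp X" C "proj X"
    by unfold_locales (rule opextD(5)[OF X])
  have "e' \<otimes>\<^bsub>egrp X\<^esub> inv\<^bsub>egrp X\<^esub> e \<in> kernel (egrp X) C (proj X)"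
    using e X eq by (simp add: kernel_def)
  then obtain b where "b \<in> carrier B" "e' \<otimes>\<^bsub>egrp X\<^esub> inv\<^bsub>egrp X\<^esub> e = incl X b"
    using opextD(8)[OF X] by auto
  moreover from this have "e' = act X b e"
    using e by (metis G.inv_solve_right' G.inv_closed act_def X incl_closed)
  ultimately show thesis using that by blast
qed

lemma incl_mult: "\<lbrakk>X \<in> Obj; b \<in> carrier B; b' \<in> carrier B\<rbrakk>
    \<Longrightarrow> incl X (b \<otimes>\<^bsub>B\<^esub> b') = incl X b \<otimes>\<^bsub>egrp X\<^esub> incl X b'"
  using opextD(2)[of X] by (auto simp: hom_def)

lemma mult_incl:
  assumes "X \<in> Obj" "b \<in> carrier B" "e \<in> carr X"
  shows "e \<otimes>\<^bsub>egrp X\<^esub> incl X b = act X (\<xi> (proj X e) b) e"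
  using act_mult_right[of X b e "\<one>\<^bsub>egrp X\<^esub>"] assms opextD(1)[of X]
  by (simp add: incl_eq_act group.is_monoid)

subsection \<open>Arrows\<close>

lemma ext_homD:
  assumes "\<sigma> \<in> ext_hom B X Y"
  shows "e \<in> carr X \<Longrightarrow> \<sigma> e \<in> carr Y"
    "\<lbrakk>e \<in> carr X; e' \<in> carr X\<rbrakk> \<Longrightarrow> \<sigma> (e \<otimes>\<^bsub>egrp X\<^esub> e') = \<sigma> e \<otimes>\<^bsub>egrp Y\<^esub> \<sigma> e'"
    "e \<in> carr X \<Longrightarrow> proj Y (\<sigma> e) = proj X e"
    "\<lbrakk>X \<in> Obj; b \<in> carrier B; e \<in> carr X\<rbrakk> \<Longrightarrow> \<sigma> (act X b e) = act Y b (\<sigma> e)"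
    "\<sigma> \<in> extensional (carr X)"
  using assms by (auto simp: ext_hom_def ehom_def hom_def act_def)

text \<open>
  Compatibility with the inclusions of \<open>B\<close> is equivariance at the unit element, so equivariance may
  replace it.
\<close>

lemma ext_homI:
  assumes XY: "X \<in> Obj" "Y \<in> Obj" and "\<sigma> \<in> extensional (carr X)"
    and "\<And>e. e \<in> carr X \<Longrightarrow> \<sigma> e \<in> carr Y"
    and "\<And>e e'. \<lbrakk>e \<in> carr X; e' \<in> carr X\<rbrakk> \<Longrightarrow> \<sigma> (e \<otimes>\<^bsub>egrp X\<^esub> e') = \<sigma> e \<otimes>\<^bsub>egrp Y\<^esub> \<sigma> e'"
    and "\<And>e. e \<in> carr X \<Longrightarrow> proj Y (\<sigma> e) = proj X e"
    and "\<And>b e. \<lbrakk>b \<in> carrier B; e \<in> carr X\<rbrakk> \<Longrightarrow> \<sigma> (act X b e) = act Y b (\<sigma> e)"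
  shows "\<sigma> \<in> ext_hom B X Y"
proof -
  have hom: "\<sigma> \<in> hom (egrp X) (egrp Y)" using assms(4,5) by (auto simp: hom_def)
  then have "\<sigma> \<one>\<^bsub>egrp X\<^esub> = \<one>\<^bsub>egrp Y\<^esub>" using hom_one opextD(1) XY by blast
  with assms(7)[of _ "\<one>\<^bsub>egrp X\<^esub>"] XY have "\<sigma> (incl X b) = incl Y b" if "b \<in> carrier B" for b
    using that by (simp add: incl_eq_act)
  with hom assms show ?thesis by (auto simp: ext_hom_def ehom_def)
qed

text \<open>
  The short five lemma: an equivariant map over \<open>C\<close> between spaces on which \<open>B\<close> acts freely and
  transitively along the fibres is bijective. Hence every arrow of extensions is invertible, and
  the arrows of extensions are the same as the arrows of butterflies, which are required to be
  isomorphisms.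
\<close>

lemma ext_hom_bij:
  assumes X: "X \<in> Obj" and Y: "Y \<in> Obj" and \<sigma>: "\<sigma> \<in> ext_hom B X Y"
  shows "bij_betw \<sigma> (carr X) (carr Y)"
proof (rule bij_betw_imageI)
  note s = ext_homD[OF \<sigma>]
  show "inj_on \<sigma> (carr X)"
  proof (rule inj_onI)
    fix e e' assume e: "e \<in> carr X" "e' \<in> carr X" and eq: "\<sigma> e = \<sigma> e'"
    then have "proj X e = proj X e'" using s(3) by metis
    then obtain b where b: "b \<in> carrier B" "e' = act X b e" using act_transitive[OF X e] by blast
    then have "act Y b (\<sigma> e) = \<sigma> e" using s X e eq by simp
    then have "b = \<one>\<^bsub>B\<^esub>" using act_fixed[OF Y b(1)] s(1) e by blast
    with b e X show "e = e'" by simp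
  qed
  show "\<sigma> ` carr X = carr Y"
  proof
    show "\<sigma> ` carr X \<subseteq> carr Y" using s(1) by blast
    show "carr Y \<subseteq> \<sigma> ` carr X"
    proof
      fix y assume y: "y \<in> carr Y"
      then obtain e where e: "e \<in> carr X" "proj X e = proj Y y"
        using fibre_nonempty[OF X, of "proj Y y"] Y by auto
      then obtain b where "b \<in> carrier B" "y = act Y b (\<sigma> e)"
        using act_transitive[OF Y, of "\<sigma> e" y] s y by auto
      with s e X show "y \<in> \<sigma> ` carr X" by (metis act_closed image_eqI)
    qed
  qed
qed

lemma ext_hom_inverse:
  assumes X: "X \<in> Obj" and Y: "Y \<in> Obj" and \<sigma>: "\<sigma> \<in> ext_hom B X Y"
  shows "(\<lambda>y \<in> carr Y. inv_into (carr X) \<sigma> y) \<in> ext_hom B Y X" (is "?g \<in> _")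
proof -
  note s = ext_homD[OF \<sigma>]
  have inj: "inj_on \<sigma> (carr X)" and im: "\<sigma> ` carr X = carr Y"
    using ext_hom_bij[OF assms] by (auto simp: bij_betw_def)
  have g: "?g y \<in> carr X" "\<sigma> (?g y) = y" if "y \<in> carr Y" for y
    using that im by (auto simp: inv_into_into f_inv_into_f)
  have eqI: "e = e'" if "e \<in> carr X" "e' \<in> carr X" "\<sigma> e = \<sigma> e'" for e e'
    using that inj by (auto dest: inj_onD)
  show ?thesis
  proof (rule ext_homI[OF Y X])
    show "proj X (?g y) = proj Y y" if "y \<in> carr Y" for y using g[OF that] s(3) by metis
    show "?g (y \<otimes>\<^bsub>egrp Y\<^esub> y') = ?g y \<otimes>\<^bsub>egrp X\<^esub> ?g y'" if "y \<in> carr Y" "y' \<in> carr Y" for y y'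
      by (rule eqI) (use that X Y g s in \<open>simp_all del: restrict_apply\<close>)
    show "?g (act Y b y) = act X b (?g y)" if "b \<in> carrier B" "y \<in> carr Y" for b y
      by (rule eqI) (use that X Y g s in \<open>simp_all del: restrict_apply\<close>)
  qed (use g in auto)
qed

end

section \<open>Baer sums\<close>

lemma pullback_group_simps [simp]:
  "(x, y) \<in> carrier (pullback_group G H f g) \<longleftrightarrow> x \<in> carrier G \<and> y \<in> carrier H \<and> f x = g y"
  "(x, y) \<otimes>\<^bsub>pullback_group G H f g\<^esub> (x', y') = (x \<otimes>\<^bsub>G\<^esub> x', y \<otimes>\<^bsub>H\<^esub> y')"
  "\<one>\<^bsub>pullback_group G H f g\<^esub> = (\<one>\<^bsub>G\<^esub>, \<one>\<^bsub>H\<^esub>)"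
  by (simp_all add: pullback_group_def)

lemma fibre_product_simps [simp]:
  "egrp (fibre_product B X Y) = pullback_group (egrp X) (egrp Y) (proj X) (proj Y)"
  "\<lbrakk>b \<in> carrier B; b' \<in> carrier B\<rbrakk> \<Longrightarrow> incl (fibre_product B X Y) (b, b') = (incl X b, incl Y b')"
  "\<lbrakk>e \<in> carrier (egrp X); e' \<in> carrier (egrp Y); proj X e = proj Y e'\<rbrakk>
     \<Longrightarrow> proj (fibre_product B X Y) (e, e') = proj X e"
  by (simp_all add: fibre_product_def Let_def)

abbreviation fibre_set :: "('b, 'c, 'e) extn \<Rightarrow> ('b, 'c, 'e) extn \<Rightarrow> ('e \<times> 'e) set" where
  "fibre_set X Y \<equiv> carrier (pullback_group (egrp X) (egrp Y) (proj X) (proj Y))"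

locale baer_sums = module_extensions C B \<xi>
  for C :: "'c monoid" and B :: "'b monoid" and \<xi> :: "'c \<Rightarrow> 'b \<Rightarrow> 'b" +
  fixes P :: "('b, 'c, 'e) baer_choice"
  assumes baer_choice: "is_baer_choice C B \<xi> P"
begin

abbreviation bsum :: "('b, 'c, 'e) extn \<Rightarrow> ('b, 'c, 'e) extn \<Rightarrow> ('b, 'c, 'e) extn"
    (infixl \<open>\<boxplus>\<close> 70) where
  "X \<boxplus> Y \<equiv> fst (P X Y)"

abbreviation q :: "('b, 'c, 'e) extn \<Rightarrow> ('b, 'c, 'e) extn \<Rightarrow> 'e \<times> 'e \<Rightarrow> 'e" where
  "q X Y \<equiv> snd (P X Y)"

lemma bsum_in [simp]: "\<lbrakk>X \<in> Obj; Y \<in> Obj\<rbrakk> \<Longrightarrow> X \<boxplus> Y \<in> Obj"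
  using baer_choice by (auto simp: is_baer_choice_def)

lemma q_hom:
  assumes "X \<in> Obj" "Y \<in> Obj"
  shows "q X Y \<in> ehom (pullback_group (egrp X) (egrp Y) (proj X) (proj Y)) (egrp (X \<boxplus> Y))"
  using baer_choice assms by (auto simp: is_baer_choice_def is_pushforward_def)

lemma q_closed [simp]:
  assumes "X \<in> Obj" "Y \<in> Obj" "e \<in> carr X" "e' \<in> carr Y" "proj X e = proj Y e'"
  shows "q X Y (e, e') \<in> carr (X \<boxplus> Y)"
proof -
  have "q X Y \<in> hom (pullback_group (egrp X) (egrp Y) (proj X) (proj Y)) (egrp (X \<boxplus> Y))"
    using q_hom[OF assms(1,2)] by (simp add: ehom_def)
  from hom_in_carrier[OF this, of "(e, e')"] show ?thesis using assms by simp
qed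

lemma proj_q [simp]:
  assumes "X \<in> Obj" "Y \<in> Obj" "e \<in> carr X" "e' \<in> carr Y" "proj X e = proj Y e'"
  shows "proj (X \<boxplus> Y) (q X Y (e, e')) = proj X e"
proof -
  have "\<forall>x \<in> fibre_set X Y. proj (X \<boxplus> Y) (q X Y x) = proj (fibre_product B X Y) x"
    using baer_choice assms(1,2) by (auto simp: is_baer_choice_def is_pushforward_def)
  then show ?thesis using assms by fastforce
qed

lemma q_mult:
  assumes "X \<in> Obj" "Y \<in> Obj" "e1 \<in> carr X" "e1' \<in> carr Y" "proj X e1 = proj Y e1'"
    "e2 \<in> carr X" "e2' \<in> carr Y" "proj X e2 = proj Y e2'"
  shows "q X Y (e1, e1') \<otimes>\<^bsub>egrp (X \<boxplus> Y)\<^esub> q X Y (e2, e2') =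
    q X Y (e1 \<otimes>\<^bsub>egrp X\<^esub> e2, e1' \<otimes>\<^bsub>egrp Y\<^esub> e2')"
proof -
  have "q X Y \<in> hom (pullback_group (egrp X) (egrp Y) (proj X) (proj Y)) (egrp (X \<boxplus> Y))"
    using q_hom[OF assms(1,2)] by (simp add: ehom_def)
  from hom_mult[OF this, of "(e1, e1')" "(e2, e2')"] show ?thesis using assms by simp
qed

lemma q_incl:
  assumes "X \<in> Obj" "Y \<in> Obj" "b \<in> carrier B" "b' \<in> carrier B"
  shows "q X Y (incl X b, incl Y b') = incl (X \<boxplus> Y) (b \<otimes>\<^bsub>B\<^esub> b')"
proof -
  have "\<forall>a \<in> carrier (B \<times>\<times> B). q X Y (incl (fibre_product B X Y) a) =
      incl (X \<boxplus> Y) ((\<lambda>(b, b'). b \<otimes>\<^bsub>B\<^esub> b') a)"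
    using baer_choice assms(1,2) unfolding is_baer_choice_def is_pushforward_def by blast
  then have "q X Y (incl (fibre_product B X Y) (b, b')) =
      incl (X \<boxplus> Y) ((\<lambda>(b, b'). b \<otimes>\<^bsub>B\<^esub> b') (b, b'))"
    by (rule bspec) (use assms in simp)
  then show ?thesis using assms by simp
qed

text \<open>
  The kernel of the fibre product is pushed forward along the multiplication of \<open>B\<close>, so both copies
  of \<open>B\<close> act through the product. The two special cases below say that \<open>q\<close> is balanced, as the map
  to a tensor product over \<open>B\<close> would be.
\<close>

lemma q_act:
  assumes "X \<in> Obj" "Y \<in> Obj" "b \<in> carrier B" "b' \<in> carrier B"
    "e \<in> carr X" "e' \<in> carr Y" "proj X e = proj Y e'"
  shows "q X Y (act X b e, act Y b' e') = act (X \<boxplus> Y) (b \<otimes>\<^bsub>B\<^esub> b') (q X Y (e, e'))"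
  using assms by (simp add: act_def q_incl[symmetric] q_mult)

lemma q_act_left:
  assumes "X \<in> Obj" "Y \<in> Obj" "b \<in> carrier B" "e \<in> carr X" "e' \<in> carr Y" "proj X e = proj Y e'"
  shows "q X Y (act X b e, e') = act (X \<boxplus> Y) b (q X Y (e, e'))"
  using q_act[of X Y b "\<one>\<^bsub>B\<^esub>" e e'] assms by simp

lemma q_act_right:
  assumes "X \<in> Obj" "Y \<in> Obj" "b \<in> carrier B" "e \<in> carr X" "e' \<in> carr Y" "proj X e = proj Y e'"
  shows "q X Y (e, act Y b e') = act (X \<boxplus> Y) b (q X Y (e, e'))"
  using q_act[of X Y "\<one>\<^bsub>B\<^esub>" b e e'] assms by simp

text \<open>
  Surjectivity of \<open>q\<close>: lift the point of \<open>C\<close> to both extensions; the resulting value lies in the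
  right fibre, and the remaining translation by \<open>B\<close> can be moved into the first component.
\<close>

lemma q_cases:
  assumes X: "X \<in> Obj" and Y: "Y \<in> Obj" and s: "s \<in> carr (X \<boxplus> Y)"
  obtains e e' where "e \<in> carr X" "e' \<in> carr Y" "proj X e = proj Y e'" "s = q X Y (e, e')"
proof -
  have "proj (X \<boxplus> Y) s \<in> carrier C" using assms by simp
  then obtain e e' where e: "e \<in> carr X" "e' \<in> carr Y"
    and p: "proj X e = proj (X \<boxplus> Y) s" "proj Y e' = proj (X \<boxplus> Y) s"
    using fibre_nonempty X Y by metis
  from p have eq: "proj X e = proj Y e'" by simp
  have "proj (X \<boxplus> Y) (q X Y (e, e')) = proj (X \<boxplus> Y) s" using X Y e p by simp
  then obtain b where "b \<in> carrier B" "s = act (X \<boxplus> Y) b (q X Y (e, e'))"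
    using act_transitive[of "X \<boxplus> Y" "q X Y (e, e')" s] X Y e eq s by auto
  then show thesis using that[of "act X b e" e'] X Y e eq by (simp add: q_act_left)
qed

lemma q_surj: "\<lbrakk>X \<in> Obj; Y \<in> Obj\<rbrakk> \<Longrightarrow> q X Y ` fibre_set X Y = carr (X \<boxplus> Y)"
proof (intro equalityI subsetI)
  fix s assume XY: "X \<in> Obj" "Y \<in> Obj" and "s \<in> carr (X \<boxplus> Y)"
  then obtain e e' where "e \<in> carr X" "e' \<in> carr Y" "proj X e = proj Y e'" "s = q X Y (e, e')"
    using q_cases by metis
  then show "s \<in> q X Y ` fibre_set X Y" by (intro image_eqI[of _ _ "(e, e')"]) simp_all
qed auto

text \<open>
  The fibres of \<open>q\<close> are the orbits of the antidiagonal \<open>b \<mapsto> (b, inv b)\<close>: the components of two points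
  with the same image differ by some \<open>b\<close> and \<open>b'\<close>, and freeness of the action on the sum forces
  \<open>b \<otimes> b' = \<one>\<close>.
\<close>

lemma q_eq_cases:
  assumes X: "X \<in> Obj" and Y: "Y \<in> Obj"
    and e: "e1 \<in> carr X" "e1' \<in> carr Y" "proj X e1 = proj Y e1'"
      "e2 \<in> carr X" "e2' \<in> carr Y" "proj X e2 = proj Y e2'"
    and eq: "q X Y (e1, e1') = q X Y (e2, e2')"
  obtains b where "b \<in> carrier B" "e2 = act X b e1" "e2' = act Y (inv\<^bsub>B\<^esub> b) e1'"
proof -
  have "proj X e1 = proj X e2" using arg_cong[OF eq, of "proj (X \<boxplus> Y)"] X Y e by simp
  then obtain b where b: "b \<in> carrier B" "e2 = act X b e1" using act_transitive[OF X] e by metis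
  have "proj Y e1' = proj Y e2'" using \<open>proj X e1 = proj X e2\<close> e by simp
  then obtain b' where b': "b' \<in> carrier B" "e2' = act Y b' e1'" using act_transitive[OF Y] e by metis
  have "act (X \<boxplus> Y) (b \<otimes>\<^bsub>B\<^esub> b') (q X Y (e1, e1')) = q X Y (e1, e1')"
    using eq q_act[of X Y b b' e1 e1'] X Y e b b' by simp
  then have "b \<otimes>\<^bsub>B\<^esub> b' = \<one>\<^bsub>B\<^esub>" using act_fixed[of "X \<boxplus> Y" "b \<otimes>\<^bsub>B\<^esub> b'" "q X Y (e1, e1')"] X Y e b b' by simp
  then have "b' = inv\<^bsub>B\<^esub> b" using b b' B.inv_equality[of b' b] by (simp add: B.m_comm)
  with b b' show thesis using that by simp
qed

lemma bsum_ext: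
  assumes "X \<in> Obj" "Y \<in> Obj"
    and "\<sigma> \<in> extensional (carr (X \<boxplus> Y))" "\<tau> \<in> extensional (carr (X \<boxplus> Y))"
    and "\<And>e e'. \<lbrakk>e \<in> carr X; e' \<in> carr Y; proj X e = proj Y e'\<rbrakk>
      \<Longrightarrow> \<sigma> (q X Y (e, e')) = \<tau> (q X Y (e, e'))"
  shows "\<sigma> = \<tau>"
  using assms(3,4) by (rule extensionalityI) (metis assms(1,2,5) q_cases)

text \<open>
  The universal property of the Baer sum: multiplicative maps over \<open>C\<close> that are equivariant in each
  argument are constant on antidiagonal orbits, and so factor through \<open>q\<close>. All structural arrows
  out of a sum of two extensions arise in this way.
\<close>

lemma bsum_universal:
  fixes f :: "'e \<times> 'e \<Rightarrow> 'e"
  assumes X: "X \<in> Obj" and Y: "Y \<in> Obj" and T: "T \<in> Obj"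
    and closed: "\<And>e e'. \<lbrakk>e \<in> carr X; e' \<in> carr Y; proj X e = proj Y e'\<rbrakk> \<Longrightarrow> f (e, e') \<in> carr T"
    and over: "\<And>e e'. \<lbrakk>e \<in> carr X; e' \<in> carr Y; proj X e = proj Y e'\<rbrakk>
      \<Longrightarrow> proj T (f (e, e')) = proj X e"
    and left: "\<And>b e e'. \<lbrakk>b \<in> carrier B; e \<in> carr X; e' \<in> carr Y; proj X e = proj Y e'\<rbrakk>
      \<Longrightarrow> f (act X b e, e') = act T b (f (e, e'))"
    and right: "\<And>b e e'. \<lbrakk>b \<in> carrier B; e \<in> carr X; e' \<in> carr Y; proj X e = proj Y e'\<rbrakk>
      \<Longrightarrow> f (e, act Y b e') = act T b (f (e, e'))"
    and mult: "\<And>e1 e1' e2 e2'. \<lbrakk>e1 \<in> carr X; e1' \<in> carr Y; proj X e1 = proj Y e1';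
        e2 \<in> carr X; e2' \<in> carr Y; proj X e2 = proj Y e2'\<rbrakk>
      \<Longrightarrow> f (e1 \<otimes>\<^bsub>egrp X\<^esub> e2, e1' \<otimes>\<^bsub>egrp Y\<^esub> e2') = f (e1, e1') \<otimes>\<^bsub>egrp T\<^esub> f (e2, e2')"
  defines "h \<equiv> induced (fibre_set X Y) (egrp (X \<boxplus> Y)) (q X Y) f"
  shows "h \<in> ext_hom B (X \<boxplus> Y) T"
    and "\<lbrakk>e \<in> carr X; e' \<in> carr Y; proj X e = proj Y e'\<rbrakk> \<Longrightarrow> h (q X Y (e, e')) = f (e, e')"
proof -
  have fibres: "f x = f y"
    if xy: "x \<in> fibre_set X Y" "y \<in> fibre_set X Y" "q X Y x = q X Y y" for x y
  proof -
    obtain e1 e1' e2 e2' where [simp]: "x = (e1, e1')" "y = (e2, e2')" by (metis surj_pair)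
    obtain b where "b \<in> carrier B" "e2 = act X b e1" "e2' = act Y (inv\<^bsub>B\<^esub> b) e1'"
      by (rule q_eq_cases[OF X Y, of e1 e1' e2 e2']) (use xy in auto)
    with xy X Y T closed show ?thesis by (simp add: left right)
  qed
  have ext: "h \<in> extensional (carr (X \<boxplus> Y))"
    unfolding h_def using fibres by (rule induced_well_defined(1)[OF q_surj[OF X Y]])
  have ind: "h (q X Y x) = f x" if "x \<in> fibre_set X Y" for x
    unfolding h_def using fibres that by (rule induced_well_defined(2)[OF q_surj[OF X Y]])
  show hq: "h (q X Y (e, e')) = f (e, e')"
    if "e \<in> carr X" "e' \<in> carr Y" "proj X e = proj Y e'" for e e'
    using ind[of "(e, e')"] that by simp
  show "h \<in> ext_hom B (X \<boxplus> Y) T"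
  proof (rule ext_homI)
    show "h \<in> extensional (carr (X \<boxplus> Y))" by (rule ext)
    fix s assume "s \<in> carr (X \<boxplus> Y)"
    then obtain e e' where s: "e \<in> carr X" "e' \<in> carr Y" "proj X e = proj Y e'" "s = q X Y (e, e')"
      using q_cases X Y by metis
    show "h s \<in> carr T" using s by (simp add: hq closed)
    show "proj T (h s) = proj (X \<boxplus> Y) s" using s X Y by (simp add: hq over)
    show "h (act (X \<boxplus> Y) b s) = act T b (h s)" if "b \<in> carrier B" for b
      using s X Y that by (simp add: hq left q_act_left[symmetric])
    fix t assume "t \<in> carr (X \<boxplus> Y)"
    then obtain d d' where t: "d \<in> carr X" "d' \<in> carr Y" "proj X d = proj Y d'" "t = q X Y (d, d')"
      using q_cases X Y by metis
    show "h (s \<otimes>\<^bsub>egrp (X \<boxplus> Y)\<^esub> t) = h s \<otimes>\<^bsub>egrp T\<^esub> h t"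
      using s t X Y by (simp add: hq mult q_mult)
  qed (use X Y T in simp_all)
qed

end

section \<open>Existence of Baer sums\<close>

lemma pullback_group_is_group:
  assumes "group G" "group H" "group K" "f \<in> hom G K" "g \<in> hom H K"
  shows "group (pullback_group G H f g)"
proof -
  interpret G: group G by fact
  interpret H: group H by fact
  interpret K: group K by fact
  interpret P: group "G \<times>\<times> H" by (intro DirProd_group assms)
  interpret f: group_hom G K f by unfold_locales fact
  interpret g: group_hom H K g by unfold_locales fact
  have "subgroup {(x, y). x \<in> carrier G \<and> y \<in> carrier H \<and> f x = g y} (G \<times>\<times> H)"
  proof (rule P.subgroupI)
    show "{(x, y). x \<in> carrier G \<and> y \<in> carrier H \<and> f x = g y} \<noteq> {}"
      by (auto intro!: exI[of _ \<open>\<one>\<^bsub>G\<^esub>\<close>] exI[of _ \<open>\<one>\<^bsub>H\<^esub>\<close>])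
  qed (auto simp: inv_DirProd assms)
  then show ?thesis unfolding pullback_group_def by (rule P.subgroup_imp_group)
qed

context module_extensions
begin

lemma fibre_group: "\<lbrakk>X \<in> Obj; Y \<in> Obj\<rbrakk> \<Longrightarrow> group (pullback_group (egrp X) (egrp Y) (proj X) (proj Y))"
  by (rule pullback_group_is_group[OF _ _ C.group_axioms]) (rule opextD; assumption)+

lemma fibre_product_extension:
  assumes X: "X \<in> Obj" and Y: "Y \<in> Obj"
  shows "is_extension C (B \<times>\<times> B) (fibre_product B X Y)"
  unfolding is_extension_def
proof (intro conjI)
  note x = opextD[OF X] and y = opextD[OF Y]
  show "incl (fibre_product B X Y) \<in> ehom (B \<times>\<times> B) (egrp (fibre_product B X Y))"
    using X Y by (auto simp: ehom_def hom_def incl_mult) (auto simp: fibre_product_def Let_def)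
  show "inj_on (incl (fibre_product B X Y)) (carrier (B \<times>\<times> B))"
    by (rule inj_onI) (auto dest: inj_onD[OF x(4)] inj_onD[OF y(4)])
  show "proj (fibre_product B X Y) \<in> ehom (egrp (fibre_product B X Y)) C"
    using X Y by (auto simp: ehom_def hom_def) (auto simp: fibre_product_def Let_def)
  show "proj (fibre_product B X Y) ` carrier (egrp (fibre_product B X Y)) = carrier C"
  proof (intro equalityI subsetI)
    fix c assume "c \<in> carrier C"
    then obtain e e' where "e \<in> carr X" "e' \<in> carr Y" "proj X e = c" "proj Y e' = c"
      using fibre_nonempty X Y by metis
    then show "c \<in> proj (fibre_product B X Y) ` carrier (egrp (fibre_product B X Y))"
      by (intro image_eqI[of _ _ "(e, e')"]) simp_all
  qed (use X Y in auto)
  show "kernel (egrp (fibre_product B X Y)) C (proj (fibre_product B X Y)) =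
    incl (fibre_product B X Y) ` carrier (B \<times>\<times> B)"
  proof (intro equalityI subsetI)
    fix z assume "z \<in> kernel (egrp (fibre_product B X Y)) C (proj (fibre_product B X Y))"
    then obtain e e' where z: "z = (e, e')" "e \<in> kernel (egrp X) C (proj X)" "e' \<in> kernel (egrp Y) C (proj Y)"
      by (cases z) (auto simp: kernel_def)
    then obtain b b' where "b \<in> carrier B" "b' \<in> carrier B" "e = incl X b" "e' = incl Y b'"
      using x(8) y(8) by auto
    then show "z \<in> incl (fibre_product B X Y) ` carrier (B \<times>\<times> B)"
      by (intro image_eqI[of _ _ "(b, b')"]) (simp_all add: z)
  qed (use X Y in \<open>auto simp: kernel_def\<close>)
qed (use X Y fibre_group in \<open>auto intro: C.group_axioms DirProd_group B.group_axioms\<close>)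

text \<open>
  The quotient of the fibre product by the antidiagonal has to be realised inside the type of the
  elements of the extensions. A section \<open>s\<close> of the projection of \<open>Y\<close> picks from each antidiagonal
  orbit the unique pair whose second component lies in the image of \<open>s\<close>; its first component then
  identifies the quotient with the carrier of \<open>X\<close>. The map \<open>f\<close> below sends a pair to the first
  component of that representative, and the sum is the group structure on the carrier of \<open>X\<close> that
  is transported along \<open>f\<close>.
\<close>

lemma baer_sum_exists:
  fixes X Y :: "('b, 'c, 'e) extn"
  assumes X: "X \<in> Obj" and Y: "Y \<in> Obj"
  shows "\<exists>(S :: ('b, 'c, 'e) extn) q. S \<in> Obj \<and>
    is_pushforward C (B \<times>\<times> B) (fibre_product B X Y) (\<lambda>(b, b'). b \<otimes>\<^bsub>B\<^esub> b') B S q"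
proof -
  let ?P = "pullback_group (egrp X) (egrp Y) (proj X) (proj Y)"
  interpret X: group "egrp X" by (rule opextD(1)[OF X])
  interpret Y: group "egrp Y" by (rule opextD(1)[OF Y])
  interpret P: group ?P by (rule fibre_group[OF X Y])
  define s where "s c = (SOME e'. e' \<in> carr Y \<and> proj Y e' = c)" for c
  have s: "s c \<in> carr Y" "proj Y (s c) = c" if "c \<in> carrier C" for c
    using someI_ex[of "\<lambda>e'. e' \<in> carr Y \<and> proj Y e' = c"] fibre_nonempty[OF Y that]
    unfolding s_def by auto
  \<comment> \<open>the displacement of \<open>e'\<close> from the section\<close>
  define d where "d e' = (THE b. b \<in> carrier B \<and> e' = act Y b (s (proj Y e')))" for e'
  have d_act_s: "d (act Y b (s c)) = b" if "b \<in> carrier B" "c \<in> carrier C" for b c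
    unfolding d_def
    by (rule the_equality) (use that Y s act_free[OF Y, of _ _ "s c"] in auto)
  have d: "d e' \<in> carrier B" "act Y (d e') (s (proj Y e')) = e'" if e': "e' \<in> carr Y" for e'
  proof -
    have c: "proj Y e' \<in> carrier C" using Y e' by simp
    then obtain b where "b \<in> carrier B" "e' = act Y b (s (proj Y e'))"
      using act_transitive[OF Y _ e', of "s (proj Y e')"] s by metis
    then show "d e' \<in> carrier B" "act Y (d e') (s (proj Y e')) = e'" using d_act_s c by metis+
  qed
  have d_act: "d (act Y b e') = b \<otimes>\<^bsub>B\<^esub> d e'" if b: "b \<in> carrier B" and e': "e' \<in> carr Y" for b e'
  proof -
    have c: "proj Y e' \<in> carrier C" using Y e' by simp
    have "act Y b e' = act Y b (act Y (d e') (s (proj Y e')))" using d(2)[OF e'] by simp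
    also have "\<dots> = act Y (b \<otimes>\<^bsub>B\<^esub> d e') (s (proj Y e'))"
      using b d(1)[OF e'] s[OF c] Y by simp
    finally show ?thesis using d_act_s[OF _ c] b d(1)[OF e'] by simp
  qed
  define f where "f = (\<lambda>(e, e'). act X (d e') e)"
  have f_in: "f (e, e') \<in> carr X" "proj X (f (e, e')) = proj X e"
    if "e \<in> carr X" "e' \<in> carr Y" for e e'
    using that X d by (simp_all add: f_def)
  have f_left: "f (act X b e, e') = act X b (f (e, e'))"
    if "b \<in> carrier B" "e \<in> carr X" "e' \<in> carr Y" for b e e'
    using that X d by (simp add: f_def B.m_comm)
  have f_right: "f (e, act Y b e') = act X b (f (e, e'))"
    if "b \<in> carrier B" "e \<in> carr X" "e' \<in> carr Y" for b e e'
    using that X d by (simp add: f_def d_act)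
  have f_image: "f ` carrier ?P = carr X"
  proof (intro equalityI subsetI)
    fix e assume e: "e \<in> carr X"
    then have c: "proj X e \<in> carrier C" using X by simp
    have "act Y \<one>\<^bsub>B\<^esub> (s (proj X e)) = s (proj X e)" using Y s[OF c] by simp
    then have "d (s (proj X e)) = \<one>\<^bsub>B\<^esub>" using d_act_s[of "\<one>\<^bsub>B\<^esub>" "proj X e"] c by simp
    then show "e \<in> f ` carrier ?P"
      by (intro image_eqI[of _ _ "(e, s (proj X e))"]) (use e c s X in \<open>simp_all add: f_def\<close>)
  qed (auto simp: f_in)
  \<comment> \<open>the antidiagonal, whose image is the kernel of \<open>f\<close>\<close>
  define k where "k b = (incl X b, incl Y (inv\<^bsub>B\<^esub> b))" for b
  have k_hom: "group_hom B ?P k"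
    by unfold_locales (use X Y in \<open>auto simp: hom_def k_def incl_mult B.inv_mult\<close>)
  have k_mult: "k b \<otimes>\<^bsub>?P\<^esub> (e, e') = (act X b e, act Y (inv\<^bsub>B\<^esub> b) e')" for b e e'
    by (simp add: k_def act_def)
  have k_in: "k b \<in> carrier ?P" if "b \<in> carrier B" for b
    using that X Y by (simp add: k_def)
  have weak: "weak_group_morphism f (k ` carrier B) ?P"
  proof (rule weak_group_morphismsI)
    have "x \<otimes>\<^bsub>?P\<^esub> h \<otimes>\<^bsub>?P\<^esub> inv\<^bsub>?P\<^esub> x \<in> k ` carrier B"
      if x: "x \<in> carrier ?P" and h: "h \<in> k ` carrier B" for x h
    proof -
      obtain e e' where e: "x = (e, e')" "e \<in> carr X" "e' \<in> carr Y" "proj X e = proj Y e'"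
        using x by (cases x) auto
      obtain b where b: "b \<in> carrier B" "h = k b" using h by blast
      let ?b = "\<xi> (proj Y e') b"
      have c: "?b \<in> carrier B" using b e Y by simp
      have "x \<otimes>\<^bsub>?P\<^esub> h = k ?b \<otimes>\<^bsub>?P\<^esub> x"
        using e b X Y by (simp add: k_mult) (simp add: k_def mult_incl xi_inv)
      then have "x \<otimes>\<^bsub>?P\<^esub> h \<otimes>\<^bsub>?P\<^esub> inv\<^bsub>?P\<^esub> x = k ?b"
        using x k_in[OF c] k_in[OF b(1)] b by (simp add: P.m_assoc del: pullback_group_simps)
      then show ?thesis using c by blast
    qed
    then show "k ` carrier B \<lhd> ?P"
      using P.normal_inv_iff group_hom.img_is_subgroup[OF k_hom] by blast
  next
    fix x y assume x: "x \<in> carrier ?P" and y: "y \<in> carrier ?P"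
    obtain e1 e1' where e1: "x = (e1, e1')" "e1 \<in> carr X" "e1' \<in> carr Y" "proj X e1 = proj Y e1'"
      using x by (cases x) auto
    obtain e2 e2' where e2: "y = (e2, e2')" "e2 \<in> carr X" "e2' \<in> carr Y" "proj X e2 = proj Y e2'"
      using y by (cases y) auto
    have "x \<otimes>\<^bsub>?P\<^esub> inv\<^bsub>?P\<^esub> y \<in> k ` carrier B \<longleftrightarrow> (\<exists>b \<in> carrier B. x = k b \<otimes>\<^bsub>?P\<^esub> y)"
      unfolding image_iff
      by (rule bex_cong[OF refl]) (metis P.inv_solve_right[OF k_in x y])
    also have "\<dots> \<longleftrightarrow> f x = f y"
    proof
      assume "\<exists>b \<in> carrier B. x = k b \<otimes>\<^bsub>?P\<^esub> y"
      then obtain b where "b \<in> carrier B" "x = (act X b e2, act Y (inv\<^bsub>B\<^esub> b) e2')"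
        using e2 k_mult by auto
      then show "f x = f y" using e2 X Y by (simp add: f_left f_right f_in)
    next
      assume eq: "f x = f y"
      then have "proj X e2 = proj X e1" using e1 e2 f_in(2) by metis
      then obtain b where b: "b \<in> carrier B" "e1 = act X b e2"
        using act_transitive[OF X] e1 e2 by metis
      have "proj Y e2' = proj Y e1'" using \<open>proj X e2 = proj X e1\<close> e1 e2 by simp
      then obtain b' where b': "b' \<in> carrier B" "e1' = act Y b' e2'"
        using act_transitive[OF Y] e1 e2 by metis
      have "act X (b \<otimes>\<^bsub>B\<^esub> b') (f y) = f x"
        using b b' e1(1) e2 X Y by (simp add: f_left f_right f_in B.m_comm)
      then have "b \<otimes>\<^bsub>B\<^esub> b' = \<one>\<^bsub>B\<^esub>"
        using act_fixed[OF X, of "b \<otimes>\<^bsub>B\<^esub> b'" "f y"] eq b b' e2 f_in by simp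
      then have "b' = inv\<^bsub>B\<^esub> b" using b b' B.inv_equality[of b' b] by (simp add: B.m_comm)
      then show "\<exists>b \<in> carrier B. x = k b \<otimes>\<^bsub>?P\<^esub> y" using b b' e1 e2 k_mult by auto
    qed
    finally show "f x = f y \<longleftrightarrow> x \<otimes>\<^bsub>?P\<^esub> inv\<^bsub>?P\<^esub> y \<in> k ` carrier B" ..
  qed
  interpret S: group "image_group f ?P" by (rule P.image_group_is_group[OF weak])
  have f_hom: "f \<in> hom ?P (image_group f ?P)" by (rule P.weak_group_morphism_is_hom[OF weak])
  let ?S = "\<lparr>egrp = image_group f ?P, incl = (\<lambda>b \<in> carrier B. f (incl X b, \<one>\<^bsub>egrp Y\<^esub>)), proj = proj X\<rparr>"
  have carr_S: "carr ?S = carr X" by (simp add: image_group_carrier f_image)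
  have S_cases: thesis
    if "e \<in> carr X" "\<And>x x'. \<lbrakk>x \<in> carr X; x' \<in> carr Y; proj X x = proj Y x'; e = f (x, x')\<rbrakk> \<Longrightarrow> thesis"
    for e thesis
  proof -
    have "e \<in> f ` carrier ?P" using that(1) f_image by simp
    then obtain x x' where "e = f (x, x')" "(x, x') \<in> carrier ?P" by auto
    then show thesis using that(2)[of x x'] by simp
  qed
  have S_mult: "f (e1, e1') \<otimes>\<^bsub>image_group f ?P\<^esub> f (e2, e2') = f (e1 \<otimes>\<^bsub>egrp X\<^esub> e2, e1' \<otimes>\<^bsub>egrp Y\<^esub> e2')"
    if "e1 \<in> carr X" "e1' \<in> carr Y" "proj X e1 = proj Y e1'"
      "e2 \<in> carr X" "e2' \<in> carr Y" "proj X e2 = proj Y e2'" for e1 e1' e2 e2'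
    using hom_mult[OF f_hom, of "(e1, e1')" "(e2, e2')"] that by simp
  \<comment> \<open>the unit of the new group, in general different from the unit of \<open>X\<close> because \<open>s\<close> need not
    preserve units\<close>
  define z where "z = f (\<one>\<^bsub>egrp X\<^esub>, \<one>\<^bsub>egrp Y\<^esub>)"
  have z: "z \<in> carr X" "proj X z = \<one>\<^bsub>C\<^esub>" using f_in X Y by (simp_all add: z_def)
  have incl_S: "incl ?S b = act X b z" if "b \<in> carrier B" for b
    using that X Y by (simp add: z_def incl_eq_act f_left)
  have ext_S: "is_extension C B ?S" unfolding is_extension_def
  proof (intro conjI)
    show "incl ?S \<in> ehom B (egrp ?S)"
      using X Y by (auto simp: ehom_def hom_def S_mult incl_mult carr_S[simplified] f_in)
    show "inj_on (incl ?S) (carrier B)"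
      by (rule inj_onI) (metis incl_S act_free[OF X _ _ z(1)])
    have "proj X (e \<otimes>\<^bsub>egrp ?S\<^esub> e') = proj X e \<otimes>\<^bsub>C\<^esub> proj X e'"
      if e: "e \<in> carr X" "e' \<in> carr X" for e e'
    proof -
      obtain x x' where x: "x \<in> carr X" "x' \<in> carr Y" "proj X x = proj Y x'" "e = f (x, x')"
        by (rule S_cases[OF e(1)])
      obtain y y' where y: "y \<in> carr X" "y' \<in> carr Y" "proj X y = proj Y y'" "e' = f (y, y')"
        by (rule S_cases[OF e(2)])
      show ?thesis using x y X Y by (simp add: S_mult f_in)
    qed
    then show "proj ?S \<in> ehom (egrp ?S) C"
      using X opextD(6)[OF X] carr_S by (auto simp: ehom_def hom_def)
    show "proj ?S ` carr ?S = carrier C" using opextD(7)[OF X] carr_S by simp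
    have "{e \<in> carr X. proj X e = \<one>\<^bsub>C\<^esub>} = (\<lambda>b. act X b z) ` carrier B"
      using X z by (auto elim: act_transitive[OF X z(1)])
    then show "kernel (egrp ?S) C (proj ?S) = incl ?S ` carrier B"
      using carr_S incl_S by (simp add: kernel_def)
  qed (use C.group_axioms B.group_axioms S.group_axioms in auto)
  have "incl ?S (\<xi> (proj ?S e) b) = e \<otimes>\<^bsub>egrp ?S\<^esub> incl ?S b \<otimes>\<^bsub>egrp ?S\<^esub> inv\<^bsub>egrp ?S\<^esub> e"
    if e: "e \<in> carr ?S" and b: "b \<in> carrier B" for e b
  proof -
    obtain x x' where x: "x \<in> carr X" "x' \<in> carr Y" "proj X x = proj Y x'" "e = f (x, x')"
      by (rule S_cases) (use e carr_S in auto)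
    have "incl ?S (\<xi> (proj ?S e) b) \<otimes>\<^bsub>egrp ?S\<^esub> e = e \<otimes>\<^bsub>egrp ?S\<^esub> incl ?S b"
      using x b X Y by (simp add: S_mult f_in mult_incl) (simp add: act_def)
    moreover have "incl ?S (\<xi> (proj ?S e) b) \<in> carr ?S" "incl ?S b \<in> carr ?S"
      using e b X z unfolding carr_S by (subst incl_S; simp)+
    ultimately show ?thesis using e S.inv_solve_right by simp
  qed
  with ext_S have "?S \<in> Obj" unfolding opext_def by blast
  moreover have "is_pushforward C (B \<times>\<times> B) (fibre_product B X Y) (\<lambda>(b, b'). b \<otimes>\<^bsub>B\<^esub> b') B ?S
      (restrict f (carrier ?P))"
    unfolding is_pushforward_def
  proof (intro conjI)
    show "is_extension C (B \<times>\<times> B) (fibre_product B X Y)" by (rule fibre_product_extension[OF X Y])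
    show "(\<lambda>(b, b'). b \<otimes>\<^bsub>B\<^esub> b') \<in> hom (B \<times>\<times> B) B"
      by (auto simp: hom_def B.m_ac)
    show "restrict f (carrier ?P) \<in> ehom (egrp (fibre_product B X Y)) (egrp ?S)"
      using f_hom P.m_closed by (auto simp: ehom_def hom_def)
    show "\<forall>a \<in> carrier (B \<times>\<times> B). restrict f (carrier ?P) (incl (fibre_product B X Y) a) =
        incl ?S ((\<lambda>(b, b'). b \<otimes>\<^bsub>B\<^esub> b') a)"
    proof
      fix a assume "a \<in> carrier (B \<times>\<times> B)"
      then obtain b b' where a: "a = (b, b')" "b \<in> carrier B" "b' \<in> carrier B" by auto
      then show "restrict f (carrier ?P) (incl (fibre_product B X Y) a) =
          incl ?S ((\<lambda>(b, b'). b \<otimes>\<^bsub>B\<^esub> b') a)"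
        using X Y z by (simp add: f_left f_right incl_eq_act z_def[symmetric] B.m_comm)
    qed
    show "\<forall>x \<in> carrier (egrp (fibre_product B X Y)).
        proj ?S (restrict f (carrier ?P) x) = proj (fibre_product B X Y) x"
      using f_in by auto
  qed (rule ext_S)
  ultimately show ?thesis by blast
qed

end

section \<open>The symmetric monoidal structure on extensions\<close>

locale pointed_baer_sums = baer_sums C B \<xi> P
  for C :: "'c monoid" and B :: "'b monoid" and \<xi> :: "'c \<Rightarrow> 'b \<Rightarrow> 'b"
    and P :: "('b, 'c, 'e) baer_choice" +
  fixes \<iota> :: "'b \<times> 'c \<Rightarrow> 'e"
  assumes inj_iota: "inj_on \<iota> (carrier B \<times> carrier C)"
begin

subsection \<open>The split extension\<close>

abbreviation U :: "('b, 'c, 'e) extn" where "U \<equiv> split_ext C B \<xi> \<iota>"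

abbreviation B_part :: "'e \<Rightarrow> 'b" where
  "B_part x \<equiv> fst (inv_into (carrier B \<times> carrier C) \<iota> x)"

lemma semidirect_group: "group (semidirect C B \<xi>)"
proof (rule groupI)
  fix x assume "x \<in> carrier (semidirect C B \<xi>)"
  then obtain b c where [simp]: "x = (b, c)" "b \<in> carrier B" "c \<in> carrier C"
    by (auto simp: semidirect_def)
  have "\<xi> (inv\<^bsub>C\<^esub> c) (inv\<^bsub>B\<^esub> b) \<otimes>\<^bsub>B\<^esub> \<xi> (inv\<^bsub>C\<^esub> c) b = \<one>\<^bsub>B\<^esub>"
    by (simp add: xi_mult[symmetric] xi_unit)
  then show "\<exists>y \<in> carrier (semidirect C B \<xi>). y \<otimes>\<^bsub>semidirect C B \<xi>\<^esub> x = \<one>\<^bsub>semidirect C B \<xi>\<^esub>"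
    by (intro bexI[of _ "(\<xi> (inv\<^bsub>C\<^esub> c) (inv\<^bsub>B\<^esub> b), inv\<^bsub>C\<^esub> c)"]) (auto simp: semidirect_def)
qed (auto simp: semidirect_def xi_mult xi_comp B.m_assoc C.m_assoc)

lemma split_ext_simps [simp]:
  "carr U = \<iota> ` (carrier B \<times> carrier C)"
  "\<one>\<^bsub>egrp U\<^esub> = \<iota> (\<one>\<^bsub>B\<^esub>, \<one>\<^bsub>C\<^esub>)"
  "b \<in> carrier B \<Longrightarrow> incl U b = \<iota> (b, \<one>\<^bsub>C\<^esub>)"
  "\<lbrakk>b \<in> carrier B; c \<in> carrier C\<rbrakk> \<Longrightarrow> proj U (\<iota> (b, c)) = c"
  "\<lbrakk>b \<in> carrier B; c \<in> carrier C; b' \<in> carrier B; c' \<in> carrier C\<rbrakk>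
     \<Longrightarrow> \<iota> (b, c) \<otimes>\<^bsub>egrp U\<^esub> \<iota> (b', c') = \<iota> (b \<otimes>\<^bsub>B\<^esub> \<xi> c b', c \<otimes>\<^bsub>C\<^esub> c')"
  "\<lbrakk>b \<in> carrier B; c \<in> carrier C\<rbrakk> \<Longrightarrow> B_part (\<iota> (b, c)) = b"
  using inj_iota by (auto simp: split_ext_def image_group_def semidirect_def)

lemma split_ext_in [simp]: "U \<in> Obj"
proof -
  interpret G: group "egrp U"
    using group.inj_imp_image_group_is_group[OF semidirect_group, of \<iota>] inj_iota
    by (simp add: split_ext_def semidirect_def)
  have "is_extension C B U" unfolding is_extension_def
  proof (intro conjI)
    show "incl U \<in> ehom B (egrp U)"
      by (auto simp: ehom_def hom_def) (simp add: split_ext_def)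
    show "inj_on (incl U) (carrier B)"
      by (rule inj_onI) (simp add: inj_on_eq_iff[OF inj_iota])
    show "proj U \<in> ehom (egrp U) C"
      by (auto simp: ehom_def hom_def) (simp add: split_ext_def image_group_def semidirect_def)
    show "proj U ` carr U = carrier C" by (force simp: image_iff)
    show "kernel (egrp U) C (proj U) = incl U ` carrier B"
      by (auto simp: kernel_def image_iff)
  qed (use C.group_axioms B.group_axioms G.group_axioms in auto)
  moreover have "incl U (\<xi> (proj U e) b) = e \<otimes>\<^bsub>egrp U\<^esub> incl U b \<otimes>\<^bsub>egrp U\<^esub> inv\<^bsub>egrp U\<^esub> e"
    if e: "e \<in> carr U" and b: "b \<in> carrier B" for e b
  proof -
    have "incl U (\<xi> (proj U e) b) \<otimes>\<^bsub>egrp U\<^esub> e = e \<otimes>\<^bsub>egrp U\<^esub> incl U b"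
      using e b by (auto simp: xi_unit B.m_comm)
    moreover have "incl U (\<xi> (proj U e) b) \<in> carr U" "incl U b \<in> carr U" using e b by auto
    ultimately show ?thesis using e G.inv_solve_right by auto
  qed
  ultimately show ?thesis unfolding opext_def by blast
qed

lemma split_ext_cases:
  assumes "u \<in> carr U"
  obtains b c where "b \<in> carrier B" "c \<in> carrier C" "u = \<iota> (b, c)"
  using assms by auto

lemma act_split_ext [simp]: "\<lbrakk>b \<in> carrier B; b' \<in> carrier B; c \<in> carrier C\<rbrakk>
    \<Longrightarrow> act U b (\<iota> (b', c)) = \<iota> (b \<otimes>\<^bsub>B\<^esub> b', c)"
  by (simp add: act_def)

subsection \<open>The structural arrows\<close>

abbreviation M :: "(('b, 'c, 'e) extn, 'e \<Rightarrow> 'e) smcat" where "M \<equiv> H2 C B \<xi> \<iota> P"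

lemma H2_simps [simp]:
  "objs M = Obj" "homs M = ext_hom B" "idn M X = (\<lambda>e \<in> carr X. e)"
  "cmp M X Y Z \<tau> \<sigma> = compose (carr X) \<tau> \<sigma>" "tens M X Y = X \<boxplus> Y" "tunit M = U"
  by (simp_all add: H2_def Let_def)

lemma idn_hom [simp]: "X \<in> Obj \<Longrightarrow> (\<lambda>e \<in> carr X. e) \<in> ext_hom B X X"
  by (rule ext_homI) simp_all

lemma cmp_hom [simp]:
  "\<lbrakk>X \<in> Obj; \<sigma> \<in> ext_hom B X Y; \<tau> \<in> ext_hom B Y Z\<rbrakk> \<Longrightarrow> compose (carr X) \<tau> \<sigma> \<in> ext_hom B X Z"
  by (auto simp: ext_hom_def ehom_def compose_def hom_def Pi_iff)

text \<open>
  Each structural arrow is determined by its values on \<open>q\<close>; the equations for these values are the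
  rewrite rules from which all coherence laws follow.
\<close>

lemma tarr_hom_and_q:
  assumes X: "X \<in> Obj" "X' \<in> Obj" "Y \<in> Obj" "Y' \<in> Obj"
    and s: "\<sigma> \<in> ext_hom B X X'" and t: "\<tau> \<in> ext_hom B Y Y'"
  shows tarr_hom: "tarr M X X' Y Y' \<sigma> \<tau> \<in> ext_hom B (X \<boxplus> Y) (X' \<boxplus> Y')"
    and tarr_q: "\<lbrakk>e \<in> carr X; e' \<in> carr Y; proj X e = proj Y e'\<rbrakk>
      \<Longrightarrow> tarr M X X' Y Y' \<sigma> \<tau> (q X Y (e, e')) = q X' Y' (\<sigma> e, \<tau> e')"
proof -
  let ?f = "\<lambda>(e, e'). q X' Y' (\<sigma> e, \<tau> e')"
  have eq: "tarr M X X' Y Y' \<sigma> \<tau> = induced (fibre_set X Y) (egrp (X \<boxplus> Y)) (q X Y) ?f"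
    by (simp add: H2_def Let_def)
  note u = bsum_universal[of X Y "X' \<boxplus> Y'" ?f, folded eq]
  show "tarr M X X' Y Y' \<sigma> \<tau> \<in> ext_hom B (X \<boxplus> Y) (X' \<boxplus> Y')"
    by (rule u(1)) (use X ext_homD[OF s] ext_homD[OF t] in
      \<open>simp_all add: q_act_left q_act_right q_mult\<close>)
  show "tarr M X X' Y Y' \<sigma> \<tau> (q X Y (e, e')) = q X' Y' (\<sigma> e, \<tau> e')"
    if "e \<in> carr X" "e' \<in> carr Y" "proj X e = proj Y e'"
    by (subst u(2)) (use that X ext_homD[OF s] ext_homD[OF t] in
      \<open>simp_all add: q_act_left q_act_right q_mult\<close>)
qed

lemma symm_hom_and_q:
  assumes X: "X \<in> Obj" "Y \<in> Obj"
  shows symm_hom: "symm M X Y \<in> ext_hom B (X \<boxplus> Y) (Y \<boxplus> X)"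
    and symm_q: "\<lbrakk>e \<in> carr X; e' \<in> carr Y; proj X e = proj Y e'\<rbrakk>
      \<Longrightarrow> symm M X Y (q X Y (e, e')) = q Y X (e', e)"
proof -
  let ?f = "\<lambda>(e, e'). q Y X (e', e)"
  have eq: "symm M X Y = induced (fibre_set X Y) (egrp (X \<boxplus> Y)) (q X Y) ?f"
    by (simp add: H2_def Let_def)
  note u = bsum_universal[of X Y "Y \<boxplus> X" ?f, folded eq]
  show "symm M X Y \<in> ext_hom B (X \<boxplus> Y) (Y \<boxplus> X)"
    by (rule u(1)) (use X in \<open>simp_all add: q_act_left q_act_right q_mult\<close>)
  show "symm M X Y (q X Y (e, e')) = q Y X (e', e)"
    if "e \<in> carr X" "e' \<in> carr Y" "proj X e = proj Y e'"
    by (subst u(2)) (use that X in \<open>simp_all add: q_act_left q_act_right q_mult\<close>)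
qed

lemma B_part_closed [simp]: "u \<in> carr U \<Longrightarrow> B_part u \<in> carrier B"
  by (erule split_ext_cases) simp

lemma B_part_act: "\<lbrakk>b \<in> carrier B; u \<in> carr U\<rbrakk> \<Longrightarrow> B_part (act U b u) = b \<otimes>\<^bsub>B\<^esub> B_part u"
  by (erule split_ext_cases) simp

text \<open>
  The coordinate \<open>B_part\<close> is a crossed homomorphism. Its twist is the one that appears when \<open>B\<close> is
  moved past an element of an extension, which is why the unit constraints are homomorphisms.
\<close>

lemma B_part_mult: "\<lbrakk>u \<in> carr U; v \<in> carr U\<rbrakk>
    \<Longrightarrow> B_part (u \<otimes>\<^bsub>egrp U\<^esub> v) = B_part u \<otimes>\<^bsub>B\<^esub> \<xi> (proj U u) (B_part v)"
  by (elim split_ext_cases) simp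

lemma lun_hom_and_q:
  assumes X: "X \<in> Obj"
  shows lun_hom: "lun M X \<in> ext_hom B (U \<boxplus> X) X"
    and lun_q: "\<lbrakk>u \<in> carr U; e \<in> carr X; proj U u = proj X e\<rbrakk>
      \<Longrightarrow> lun M X (q U X (u, e)) = act X (B_part u) e"
proof -
  let ?f = "\<lambda>(x, e). act X (B_part x) e"
  have eq: "lun M X = induced (fibre_set U X) (egrp (U \<boxplus> X)) (q U X) ?f"
    by (simp add: H2_def Let_def act_def)
  note u = bsum_universal[of U X X ?f, folded eq]
  have *: "lun M X \<in> ext_hom B (U \<boxplus> X) X \<and> (u \<in> carr U \<longrightarrow> e \<in> carr X \<longrightarrow> proj U u = proj X e
      \<longrightarrow> lun M X (q U X (u, e)) = act X (B_part u) e)"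
    by (intro conjI impI; (rule u(1) | subst u(2)))
      (use X in \<open>simp_all add: B_part_act B_part_mult act_mult B.m_comm
        del: split_ext_simps act_split_ext\<close>)
  from * show "lun M X \<in> ext_hom B (U \<boxplus> X) X" by simp
  from * show "\<lbrakk>u \<in> carr U; e \<in> carr X; proj U u = proj X e\<rbrakk>
      \<Longrightarrow> lun M X (q U X (u, e)) = act X (B_part u) e" by simp
qed

lemma run_hom_and_q:
  assumes X: "X \<in> Obj"
  shows run_hom: "run M X \<in> ext_hom B (X \<boxplus> U) X"
    and run_q: "\<lbrakk>e \<in> carr X; u \<in> carr U; proj X e = proj U u\<rbrakk>
      \<Longrightarrow> run M X (q X U (e, u)) = act X (B_part u) e"
proof -
  let ?f = "\<lambda>(e, x). act X (B_part x) e"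
  have eq: "run M X = induced (fibre_set X U) (egrp (X \<boxplus> U)) (q X U) ?f"
    by (simp add: H2_def Let_def act_def)
  note u = bsum_universal[of X U X ?f, folded eq]
  have *: "run M X \<in> ext_hom B (X \<boxplus> U) X \<and> (e \<in> carr X \<longrightarrow> u \<in> carr U \<longrightarrow> proj X e = proj U u
      \<longrightarrow> run M X (q X U (e, u)) = act X (B_part u) e)"
    by (intro conjI impI; (rule u(1) | subst u(2)))
      (use X in \<open>simp_all add: B_part_act B_part_mult act_mult B.m_comm
        del: split_ext_simps act_split_ext\<close>)
  from * show "run M X \<in> ext_hom B (X \<boxplus> U) X" by simp
  from * show "\<lbrakk>e \<in> carr X; u \<in> carr U; proj X e = proj U u\<rbrakk>
      \<Longrightarrow> run M X (q X U (e, u)) = act X (B_part u) e" by simp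
qed

lemma bsum3_cases:
  assumes X: "X \<in> Obj" and Y: "Y \<in> Obj" and Z: "Z \<in> Obj" and s: "s \<in> carr (X \<boxplus> Y \<boxplus> Z)"
  obtains e e' e'' where "e \<in> carr X" "e' \<in> carr Y" "e'' \<in> carr Z"
    "proj X e = proj Y e'" "proj Y e' = proj Z e''" "s = q (X \<boxplus> Y) Z (q X Y (e, e'), e'')"
proof -
  obtain r e'' where r: "r \<in> carr (X \<boxplus> Y)" "e'' \<in> carr Z" "proj (X \<boxplus> Y) r = proj Z e''"
    "s = q (X \<boxplus> Y) Z (r, e'')"
    using q_cases[of "X \<boxplus> Y" Z s] X Y Z s by auto
  obtain e e' where "e \<in> carr X" "e' \<in> carr Y" "proj X e = proj Y e'" "r = q X Y (e, e')"
    using q_cases[OF X Y r(1)] by metis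
  with r X Y that[of e e' e''] show thesis by simp
qed

text \<open>
  The associativity constraint is defined on triples. Two triples with the same image differ by two
  successive antidiagonal translations, by \<open>b\<close> for the outer sum and by \<open>b'\<close> for the inner one; in
  the other bracketing the three components are translated by \<open>b' \<otimes> b\<close>, \<open>inv b'\<close> and \<open>inv b\<close>, whose
  product is the unit.
\<close>

lemma assc_hom_and_q:
  assumes X: "X \<in> Obj" and Y: "Y \<in> Obj" and Z: "Z \<in> Obj"
  shows assc_hom: "assc M X Y Z \<in> ext_hom B (X \<boxplus> Y \<boxplus> Z) (X \<boxplus> (Y \<boxplus> Z))"
    and assc_q: "\<lbrakk>e \<in> carr X; e' \<in> carr Y; e'' \<in> carr Z; proj X e = proj Y e'; proj Y e' = proj Z e''\<rbrakk>
      \<Longrightarrow> assc M X Y Z (q (X \<boxplus> Y) Z (q X Y (e, e'), e'')) = q X (Y \<boxplus> Z) (e, q Y Z (e', e''))"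
proof -
  let ?D = "{((e, e'), e''). e \<in> carr X \<and> e' \<in> carr Y \<and> e'' \<in> carr Z \<and>
    proj X e = proj Y e' \<and> proj Y e' = proj Z e''}"
  let ?p = "\<lambda>((e, e'), e''). q (X \<boxplus> Y) Z (q X Y (e, e'), e'')"
  let ?f = "\<lambda>((e, e'), e''). q X (Y \<boxplus> Z) (e, q Y Z (e', e''))"
  let ?h = "assc M X Y Z"
  have eq: "?h = induced ?D (egrp (X \<boxplus> Y \<boxplus> Z)) ?p ?f"
    by (simp add: H2_def Let_def)
  have surj: "?p ` ?D = carr (X \<boxplus> Y \<boxplus> Z)"
  proof (intro equalityI subsetI)
    fix s assume "s \<in> carr (X \<boxplus> Y \<boxplus> Z)"
    then obtain e e' e'' where "e \<in> carr X" "e' \<in> carr Y" "e'' \<in> carr Z"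
      "proj X e = proj Y e'" "proj Y e' = proj Z e''" "s = q (X \<boxplus> Y) Z (q X Y (e, e'), e'')"
      using bsum3_cases X Y Z by metis
    then show "s \<in> ?p ` ?D" by (intro image_eqI[of _ _ "((e, e'), e'')"]) simp_all
  qed (use X Y Z in auto)
  have fibres: "?f x = ?f y" if xy: "x \<in> ?D" "y \<in> ?D" "?p x = ?p y" for x y
  proof -
    obtain e1 e1' e1'' where x: "x = ((e1, e1'), e1'')" by (metis surj_pair)
    obtain e2 e2' e2'' where y: "y = ((e2, e2'), e2'')" by (metis surj_pair)
    have e: "e1 \<in> carr X" "e1' \<in> carr Y" "e1'' \<in> carr Z" "proj X e1 = proj Y e1'" "proj Y e1' = proj Z e1''"
      "e2 \<in> carr X" "e2' \<in> carr Y" "e2'' \<in> carr Z" "proj X e2 = proj Y e2'" "proj Y e2' = proj Z e2''"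
      using xy by (auto simp: x y)
    obtain b where b: "b \<in> carrier B" "q X Y (e2, e2') = act (X \<boxplus> Y) b (q X Y (e1, e1'))"
        "e2'' = act Z (inv\<^bsub>B\<^esub> b) e1''"
      by (rule q_eq_cases[of "X \<boxplus> Y" Z "q X Y (e1, e1')" e1'' "q X Y (e2, e2')" e2''])
        (use e X Y Z xy in \<open>auto simp: x y\<close>)
    have "q X Y (act X b e1, e1') = q X Y (e2, e2')" using b e X Y by (simp add: q_act_left)
    then obtain b' where b': "b' \<in> carrier B" "e2 = act X b' (act X b e1)" "e2' = act Y (inv\<^bsub>B\<^esub> b') e1'"
      by (rule q_eq_cases[OF X Y, rotated 6]) (use e X Y b in auto)
    have "b' \<otimes>\<^bsub>B\<^esub> b \<otimes>\<^bsub>B\<^esub> (inv\<^bsub>B\<^esub> b' \<otimes>\<^bsub>B\<^esub> inv\<^bsub>B\<^esub> b) = \<one>\<^bsub>B\<^esub>"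
      using b b' by (simp add: B.inv_mult[symmetric])
    with b b' e X Y Z show ?thesis by (simp add: x y q_act)
  qed
  have ext: "?h \<in> extensional (carr (X \<boxplus> Y \<boxplus> Z))"
    unfolding eq using fibres by (rule induced_well_defined(1)[OF surj])
  have "?h (?p x) = ?f x" if "x \<in> ?D" for x
    unfolding eq using fibres that by (rule induced_well_defined(2)[OF surj])
  from this[of "((e, e'), e'')" for e e' e'']
  show hq: "?h (q (X \<boxplus> Y) Z (q X Y (e, e'), e'')) = q X (Y \<boxplus> Z) (e, q Y Z (e', e''))"
    if "e \<in> carr X" "e' \<in> carr Y" "e'' \<in> carr Z" "proj X e = proj Y e'" "proj Y e' = proj Z e''"
    for e e' e'' using that by simp
  show "?h \<in> ext_hom B (X \<boxplus> Y \<boxplus> Z) (X \<boxplus> (Y \<boxplus> Z))"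
  proof (rule ext_homI)
    show "?h \<in> extensional (carr (X \<boxplus> Y \<boxplus> Z))" by (rule ext)
    fix s assume "s \<in> carr (X \<boxplus> Y \<boxplus> Z)"
    then obtain e e' e'' where s: "e \<in> carr X" "e' \<in> carr Y" "e'' \<in> carr Z"
      "proj X e = proj Y e'" "proj Y e' = proj Z e''" "s = q (X \<boxplus> Y) Z (q X Y (e, e'), e'')"
      using bsum3_cases X Y Z by metis
    show "?h s \<in> carr (X \<boxplus> (Y \<boxplus> Z))" using s X Y Z by (simp add: hq)
    show "proj (X \<boxplus> (Y \<boxplus> Z)) (?h s) = proj (X \<boxplus> Y \<boxplus> Z) s" using s X Y Z by (simp add: hq)
    show "?h (act (X \<boxplus> Y \<boxplus> Z) b s) = act (X \<boxplus> (Y \<boxplus> Z)) b (?h s)" if "b \<in> carrier B" for b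
      using s X Y Z that by (simp add: hq q_act_left[symmetric])
    fix t assume "t \<in> carr (X \<boxplus> Y \<boxplus> Z)"
    then obtain d d' d'' where t: "d \<in> carr X" "d' \<in> carr Y" "d'' \<in> carr Z"
      "proj X d = proj Y d'" "proj Y d' = proj Z d''" "t = q (X \<boxplus> Y) Z (q X Y (d, d'), d'')"
      using bsum3_cases X Y Z by metis
    show "?h (s \<otimes>\<^bsub>egrp (X \<boxplus> Y \<boxplus> Z)\<^esub> t) = ?h s \<otimes>\<^bsub>egrp (X \<boxplus> (Y \<boxplus> Z))\<^esub> ?h t"
      using s t X Y Z by (simp add: hq q_mult)
  qed (use X Y Z in simp_all)
qed

lemmas struct_hom [simp] = tarr_hom symm_hom lun_hom run_hom assc_hom
lemmas struct_q = tarr_q symm_q lun_q run_q assc_q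

subsection \<open>Coherence\<close>

lemma ext_hom_bsum_eqI:
  assumes "X \<in> Obj" "Y \<in> Obj"
    and "\<sigma> \<in> ext_hom B (X \<boxplus> Y) T" "\<tau> \<in> ext_hom B (X \<boxplus> Y) T"
    and "\<And>e e'. \<lbrakk>e \<in> carr X; e' \<in> carr Y; proj X e = proj Y e'\<rbrakk>
      \<Longrightarrow> \<sigma> (q X Y (e, e')) = \<tau> (q X Y (e, e'))"
  shows "\<sigma> = \<tau>"
  using bsum_ext[OF assms(1,2)] assms(3-5) ext_homD(5) by blast

lemma ext_hom_bsum3_eqI:
  assumes "X \<in> Obj" "Y \<in> Obj" "Z \<in> Obj"
    and "\<sigma> \<in> ext_hom B (X \<boxplus> Y \<boxplus> Z) T" "\<tau> \<in> ext_hom B (X \<boxplus> Y \<boxplus> Z) T"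
    and "\<And>e e' e''. \<lbrakk>e \<in> carr X; e' \<in> carr Y; e'' \<in> carr Z; proj X e = proj Y e'; proj Y e' = proj Z e''\<rbrakk>
      \<Longrightarrow> \<sigma> (q (X \<boxplus> Y) Z (q X Y (e, e'), e'')) = \<tau> (q (X \<boxplus> Y) Z (q X Y (e, e'), e''))"
  shows "\<sigma> = \<tau>"
proof (rule ext_hom_bsum_eqI[OF _ _ assms(4,5)])
  fix r e'' assume r: "r \<in> carr (X \<boxplus> Y)" "e'' \<in> carr Z" "proj (X \<boxplus> Y) r = proj Z e''"
  obtain e e' where "e \<in> carr X" "e' \<in> carr Y" "proj X e = proj Y e'" "r = q X Y (e, e')"
    using q_cases[OF assms(1,2) r(1)] by metis
  with r assms(1,2) show "\<sigma> (q (X \<boxplus> Y) Z (r, e'')) = \<tau> (q (X \<boxplus> Y) Z (r, e''))"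
    using assms(6)[of e e' e''] by simp
qed (use assms in simp_all)

lemma ext_hom_bsum4_eqI:
  assumes "X \<in> Obj" "Y \<in> Obj" "Z \<in> Obj" "W \<in> Obj"
    and "\<sigma> \<in> ext_hom B (X \<boxplus> Y \<boxplus> Z \<boxplus> W) T" "\<tau> \<in> ext_hom B (X \<boxplus> Y \<boxplus> Z \<boxplus> W) T"
    and "\<And>e e' e'' e'''. \<lbrakk>e \<in> carr X; e' \<in> carr Y; e'' \<in> carr Z; e''' \<in> carr W;
        proj X e = proj Y e'; proj Y e' = proj Z e''; proj Z e'' = proj W e'''\<rbrakk>
      \<Longrightarrow> \<sigma> (q (X \<boxplus> Y \<boxplus> Z) W (q (X \<boxplus> Y) Z (q X Y (e, e'), e''), e''')) =
          \<tau> (q (X \<boxplus> Y \<boxplus> Z) W (q (X \<boxplus> Y) Z (q X Y (e, e'), e''), e'''))"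
  shows "\<sigma> = \<tau>"
proof (rule ext_hom_bsum3_eqI[OF _ _ _ assms(5,6)])
  fix r e'' e''' assume r: "r \<in> carr (X \<boxplus> Y)" "e'' \<in> carr Z" "e''' \<in> carr W"
    "proj (X \<boxplus> Y) r = proj Z e''" "proj Z e'' = proj W e'''"
  obtain e e' where "e \<in> carr X" "e' \<in> carr Y" "proj X e = proj Y e'" "r = q X Y (e, e')"
    using q_cases[OF assms(1,2) r(1)] by metis
  with r assms(1,2) show "\<sigma> (q (X \<boxplus> Y \<boxplus> Z) W (q (X \<boxplus> Y) Z (r, e''), e''')) =
      \<tau> (q (X \<boxplus> Y \<boxplus> Z) W (q (X \<boxplus> Y) Z (r, e''), e'''))"
    using assms(7)[of e e' e'' e'''] by simp
qed (use assms in simp_all)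

lemma H2_category: "category M"
proof (unfold_locales, unfold H2_simps, goal_cases)
  case (5 a b c d f g h)
  then show ?case by (auto simp: compose_def ext_homD intro!: restrict_ext)
next
  case (3 a b f)
  then show ?case by (intro extensionalityI[OF _ ext_homD(5)]) (auto simp: compose_eq)
next
  case (4 a b f)
  then show ?case by (intro extensionalityI[OF _ ext_homD(5)]) (auto simp: compose_eq ext_homD)
qed (blast intro: idn_hom cmp_hom)+

lemma H2_groupoid: "groupoid M"
proof -
  interpret category M by (rule H2_category)
  show ?thesis
  proof (unfold_locales, unfold is_isomorphism_def H2_simps, goal_cases)
    case (1 X Y \<sigma>)
    let ?g = "\<lambda>y \<in> carr Y. inv_into (carr X) \<sigma> y"
    have bij: "bij_betw \<sigma> (carr X) (carr Y)" using ext_hom_bij 1 by blast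
    have "compose (carr X) ?g \<sigma> = (\<lambda>e \<in> carr X. e)"
      by (rule compose_inv_into_id[OF bij])
    moreover have "compose (carr Y) \<sigma> ?g = (\<lambda>e \<in> carr Y. e)"
      by (rule compose_id_inv_into) (use bij in \<open>simp add: bij_betw_def\<close>)
    ultimately show ?case using ext_hom_inverse 1 by blast
  qed
qed

lemma ext_hom_iso: "\<lbrakk>X \<in> Obj; Y \<in> Obj; \<sigma> \<in> ext_hom B X Y\<rbrakk> \<Longrightarrow> is_isomorphism M X Y \<sigma>"
  using groupoid.all_iso[OF H2_groupoid] by simp

lemma ext_hom_isomorphic: "\<lbrakk>X \<in> Obj; Y \<in> Obj; \<sigma> \<in> ext_hom B X Y\<rbrakk> \<Longrightarrow> isomorphic_in M X Y"
  unfolding isomorphic_in_def by (rule exI) (rule ext_hom_iso)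

text \<open>
  On iterated values of \<open>q\<close> the constraints only move brackets, exchange entries, or let the
  \<open>B\<close>-coordinate of an entry from the split extension act on its neighbour. Both sides of each
  law therefore reduce to the same value; the triangle also uses that \<open>q\<close> is balanced, because the
  two unit constraints let \<open>B\<close> act on different entries.
\<close>

lemma H2_symmetric_monoidal: "symmetric_monoidal_category M"
proof -
  interpret category M by (rule H2_category)
  note hom = cmp_hom struct_hom idn_hom bsum_in split_ext_in
  show ?thesis
  proof (unfold_locales, unfold H2_simps, goal_cases)
    \<comment> \<open>the tensor product preserves identities\<close>
    case (4 a b)
    show ?case
      by (insert 4, rule ext_hom_bsum_eqI[of a b _ "a \<boxplus> b"],
          (rule hom | assumption | simp add: tarr_q)+)
  next
    \<comment> \<open>the tensor product preserves composition\<close>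
    case (5 a a' a'' b b' b'' f f' g g')
    note [simp] = ext_homD[OF 5(7)] ext_homD[OF 5(8)] ext_homD[OF 5(9)] ext_homD[OF 5(10)]
    show ?case
      by (insert 5, rule ext_hom_bsum_eqI[of a b _ "a'' \<boxplus> b''"],
          (rule hom | assumption | simp add: compose_eq tarr_q cmp_hom[OF 5(1,7,8)] cmp_hom[OF 5(4,9,10)])+)
  next
    \<comment> \<open>naturality of the associativity constraint\<close>
    case (7 a a' b b' c c' f g h)
    note [simp] = ext_homD[OF 7(7)] ext_homD[OF 7(8)] ext_homD[OF 7(9)]
    show ?case
      by (insert 7, rule ext_hom_bsum3_eqI[of a b c _ "a' \<boxplus> (b' \<boxplus> c')"],
          (rule hom | assumption | simp add: compose_eq struct_q)+)
  next
    \<comment> \<open>naturality of the left unit constraint\<close>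
    case (9 a a' f)
    note [simp] = ext_homD[OF 9(3)]
    show ?case
      by (insert 9, rule ext_hom_bsum_eqI[of U a _ a'],
          (rule hom | assumption | simp add: compose_eq struct_q del: split_ext_simps)+)
  next
    \<comment> \<open>naturality of the right unit constraint\<close>
    case (11 a a' f)
    note [simp] = ext_homD[OF 11(3)]
    show ?case
      by (insert 11, rule ext_hom_bsum_eqI[of a U _ a'],
          (rule hom | assumption | simp add: compose_eq struct_q del: split_ext_simps)+)
  next
    \<comment> \<open>naturality of the symmetry\<close>
    case (13 a a' b b' f g)
    note [simp] = ext_homD[OF 13(5)] ext_homD[OF 13(6)]
    show ?case
      by (insert 13, rule ext_hom_bsum_eqI[of a b _ "b' \<boxplus> a'"],
          (rule hom | assumption | simp add: compose_eq struct_q)+)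
  next
    \<comment> \<open>pentagon\<close>
    case (14 a b c d)
    show ?case
      by (insert 14, rule ext_hom_bsum4_eqI[of a b c d _ "a \<boxplus> (b \<boxplus> (c \<boxplus> d))"],
          (rule hom | assumption | simp add: compose_eq struct_q)+)
  next
    \<comment> \<open>triangle\<close>
    case (15 a b)
    show ?case
      by (insert 15, rule ext_hom_bsum3_eqI[of a U b _ "a \<boxplus> b"],
          (rule hom | assumption | simp add: compose_eq struct_q q_act_left q_act_right del: split_ext_simps)+)
  next
    \<comment> \<open>hexagon\<close>
    case (16 a b c)
    show ?case
      by (insert 16, rule ext_hom_bsum3_eqI[of a b c _ "b \<boxplus> (c \<boxplus> a)"],
          (rule hom | assumption | simp add: compose_eq struct_q)+)
  next
    \<comment> \<open>the symmetry is an involution\<close>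
    case (17 a b)
    show ?case
      by (insert 17, rule ext_hom_bsum_eqI[of a b _ "a \<boxplus> b"],
          (rule hom | assumption | simp add: compose_eq struct_q)+)
  qed (auto intro: ext_hom_iso)
qed

subsection \<open>Inverses\<close>

text \<open>
  The inverse for the Baer sum: the same group over \<open>C\<close>, with \<open>B\<close> acting through inversion.
\<close>

definition opposite :: "('b, 'c, 'e) extn \<Rightarrow> ('b, 'c, 'e) extn" where
  "opposite X = X\<lparr>incl := \<lambda>b \<in> carrier B. incl X (inv\<^bsub>B\<^esub> b)\<rparr>"

lemma opposite_simps [simp]:
  "egrp (opposite X) = egrp X" "proj (opposite X) = proj X"
  "b \<in> carrier B \<Longrightarrow> act (opposite X) b e = act X (inv\<^bsub>B\<^esub> b) e"
  by (simp_all add: opposite_def act_def)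

lemma opposite_in [simp]:
  assumes X: "X \<in> Obj" shows "opposite X \<in> Obj"
proof -
  note x = opextD[OF X]
  have "incl X (inv\<^bsub>B\<^esub> (b \<otimes>\<^bsub>B\<^esub> b')) = incl X (inv\<^bsub>B\<^esub> b) \<otimes>\<^bsub>egrp X\<^esub> incl X (inv\<^bsub>B\<^esub> b')"
    if "b \<in> carrier B" "b' \<in> carrier B" for b b'
    using that x(2) by (simp add: B.inv_mult hom_mult)
  then have hom: "incl (opposite X) \<in> ehom B (egrp X)"
    using X by (auto simp: opposite_def ehom_def hom_def)
  have inj: "inj_on (incl (opposite X)) (carrier B)"
  proof (rule inj_onI)
    fix b b' assume b: "b \<in> carrier B" "b' \<in> carrier B" "incl (opposite X) b = incl (opposite X) b'"
    have "inv\<^bsub>B\<^esub> b = inv\<^bsub>B\<^esub> b'"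
      by (rule inj_onD[OF x(4)]) (use b in \<open>simp_all add: opposite_def\<close>)
    then show "b = b'" using b B.inv_inv by metis
  qed
  have im: "incl (opposite X) ` carrier B = incl X ` carrier B"
  proof -
    have "incl (opposite X) ` carrier B = incl X ` (m_inv B) ` carrier B"
      by (simp add: opposite_def image_image)
    also have "(m_inv B) ` carrier B = carrier B"
      by (auto simp: image_iff) (metis B.inv_closed B.inv_inv)
    finally show ?thesis .
  qed
  have "is_extension C B (opposite X)"
    using X hom inj im by (simp add: opext_def is_extension_def)
  moreover have "incl (opposite X) (\<xi> (proj X e) b) =
      e \<otimes>\<^bsub>egrp X\<^esub> incl (opposite X) b \<otimes>\<^bsub>egrp X\<^esub> inv\<^bsub>egrp X\<^esub> e"
    if "e \<in> carr X" "b \<in> carrier B" for e b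
    using x(9)[of e "inv\<^bsub>B\<^esub> b"] that X by (simp add: opposite_def xi_inv)
  ultimately show ?thesis by (simp add: opext_def)
qed

text \<open>
  Two elements of \<open>X\<close> in the same fibre have a difference in \<open>B\<close>. The pair of this difference and the
  common point of \<open>C\<close> is an element of the split extension, and translating both elements by the
  same element of \<open>B\<close>, which is the antidiagonal action when the second one is taken in the
  opposite extension, does not change it.
\<close>

lemma opposite_inverse:
  assumes X: "X \<in> Obj"
  shows "isomorphic_in M (X \<boxplus> opposite X) U"
proof -
  let ?d = "\<lambda>e e'. THE b. b \<in> carrier B \<and> e = act X b e'"
  let ?f = "\<lambda>(e, e'). \<iota> (?d e e', proj X e)"
  have d: "?d (act X b e) e = b" if "b \<in> carrier B" "e \<in> carr X" for b e
    by (rule the_equality) (use that X act_free[OF X _ _ _] in auto)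
  have f: "?f (act X b e, e) = \<iota> (b, proj X e)" if "b \<in> carrier B" "e \<in> carr X" for b e
    using d[OF that] that X by simp
  have cases: thesis
    if "e \<in> carr X" "e' \<in> carr (opposite X)" "proj X e = proj (opposite X) e'"
      "\<And>b. \<lbrakk>b \<in> carrier B; e = act X b e'\<rbrakk> \<Longrightarrow> thesis" for e e' thesis
    using act_transitive[OF X, of e' e] that by auto
  have "induced (fibre_set X (opposite X)) (egrp (X \<boxplus> opposite X)) (q X (opposite X)) ?f
      \<in> ext_hom B (X \<boxplus> opposite X) U"
  proof (rule bsum_universal(1)[of X "opposite X" U ?f])
    fix e e' assume ee: "e \<in> carr X" "e' \<in> carr (opposite X)" "proj X e = proj (opposite X) e'"
    then obtain b where b: "b \<in> carrier B" "e = act X b e'" by (rule cases)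
    have e': "e' \<in> carr X" using ee by simp
    show "?f (e, e') \<in> carr U" using f[OF b(1) e'] b e' X by simp
    show "proj U (?f (e, e')) = proj X e" using f[OF b(1) e'] b e' X by simp
    fix c assume c: "c \<in> carrier B"
    show "?f (act X c e, e') = act U c (?f (e, e'))"
      using f[OF b(1) e'] f[of "c \<otimes>\<^bsub>B\<^esub> b" e'] b c e' X by simp
    have "c \<otimes>\<^bsub>B\<^esub> b \<otimes>\<^bsub>B\<^esub> inv\<^bsub>B\<^esub> c = b"
      using b c by (simp add: B.m_comm[of c b] B.m_assoc)
    then have e: "e = act X (c \<otimes>\<^bsub>B\<^esub> b) (act X (inv\<^bsub>B\<^esub> c) e')"
      using b c e' X by simp
    show "?f (e, act (opposite X) c e') = act U c (?f (e, e'))"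
      using f[OF b(1) e'] f[of "c \<otimes>\<^bsub>B\<^esub> b" "act X (inv\<^bsub>B\<^esub> c) e'", folded e] b c e' X by simp
  next
    fix e e' d d'
    assume ee: "e \<in> carr X" "e' \<in> carr (opposite X)" "proj X e = proj (opposite X) e'"
      and dd: "d \<in> carr X" "d' \<in> carr (opposite X)" "proj X d = proj (opposite X) d'"
    from ee obtain b where b: "b \<in> carrier B" "e = act X b e'" by (rule cases)
    from dd obtain a where a: "a \<in> carrier B" "d = act X a d'" by (rule cases)
    have e': "e' \<in> carr X" and d': "d' \<in> carr X" using ee dd by simp_all
    have "e \<otimes>\<^bsub>egrp X\<^esub> d = act X (b \<otimes>\<^bsub>B\<^esub> \<xi> (proj X e') a) (e' \<otimes>\<^bsub>egrp X\<^esub> d')"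
      using a b e' d' X by (simp add: act_mult)
    then show "?f (e \<otimes>\<^bsub>egrp X\<^esub> d, e' \<otimes>\<^bsub>egrp (opposite X)\<^esub> d') = ?f (e, e') \<otimes>\<^bsub>egrp U\<^esub> ?f (d, d')"
      using f[OF b(1) e'] f[OF a(1) d'] f[of "b \<otimes>\<^bsub>B\<^esub> \<xi> (proj X e') a" "e' \<otimes>\<^bsub>egrp X\<^esub> d'"] a b e' d' X
      by simp
  qed (use X in simp_all)
  then show ?thesis by (rule ext_hom_isomorphic[rotated 2]) (use X in simp_all)
qed

theorem H2_symmetric_two_group: "symmetric_two_group M"
proof -
  interpret symmetric_monoidal_category M by (rule H2_symmetric_monoidal)
  interpret groupoid M by (rule H2_groupoid)
  show ?thesis
  proof (unfold_locales, unfold H2_simps)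
    fix X :: "('b, 'c, 'e) extn" assume X: "X \<in> Obj"
    then obtain \<sigma> where "is_isomorphism M (X \<boxplus> opposite X) U \<sigma>"
      using opposite_inverse by (auto simp: isomorphic_in_def)
    then have "\<sigma> \<in> ext_hom B (X \<boxplus> opposite X) U" by (simp add: is_isomorphism_def)
    then have "compose (carr (opposite X \<boxplus> X)) \<sigma> (symm M (opposite X) X)
        \<in> ext_hom B (opposite X \<boxplus> X) U"
      using X by (intro cmp_hom[OF _ symm_hom]) simp_all
    then have "isomorphic_in M (opposite X \<boxplus> X) U"
      by (rule ext_hom_isomorphic[rotated 2]) (use X in simp_all)
    with X opposite_inverse
    show "\<exists>Y \<in> Obj. isomorphic_in M (X \<boxplus> Y) U \<and> isomorphic_in M (Y \<boxplus> X) U"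
      by (intro bexI[of _ "opposite X"]) simp_all
  qed
qed

end

section \<open>Functors that leave arrows unchanged\<close>

text \<open>
  The data of a strict symmetric monoidal functor that is surjective on objects and leaves arrows
  unchanged, so that the hom-sets of \<open>N\<close> between images are those of \<open>M\<close>. Every axiom about \<open>N\<close> is then literally an
  axiom about \<open>M\<close>.
\<close>

locale arrow_preserving_strict =
  fixes M :: "('o, 'a, 'y) smcat_scheme" and N :: "('p, 'a, 'z) smcat_scheme" and F :: "'o \<Rightarrow> 'p"
  assumes objs: "objs N = F ` objs M"
    and homs: "\<lbrakk>a \<in> objs M; b \<in> objs M\<rbrakk> \<Longrightarrow> homs N (F a) (F b) = homs M a b"
    and idn: "a \<in> objs M \<Longrightarrow> idn N (F a) = idn M a"
    and cmp: "\<lbrakk>a \<in> objs M; b \<in> objs M; c \<in> objs M\<rbrakk> \<Longrightarrow> cmp N (F a) (F b) (F c) = cmp M a b c"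
    and tens: "\<lbrakk>a \<in> objs M; b \<in> objs M\<rbrakk> \<Longrightarrow> tens N (F a) (F b) = F (tens M a b)"
    and tunit: "tunit N = F (tunit M)"
    and tarr: "\<lbrakk>a \<in> objs M; a' \<in> objs M; b \<in> objs M; b' \<in> objs M\<rbrakk>
      \<Longrightarrow> tarr N (F a) (F a') (F b) (F b') = tarr M a a' b b'"
    and assc: "\<lbrakk>a \<in> objs M; b \<in> objs M; c \<in> objs M\<rbrakk>
      \<Longrightarrow> assc N (F a) (F b) (F c) = assc M a b c"
    and lun: "a \<in> objs M \<Longrightarrow> lun N (F a) = lun M a"
    and run: "a \<in> objs M \<Longrightarrow> run N (F a) = run M a"
    and symm: "\<lbrakk>a \<in> objs M; b \<in> objs M\<rbrakk> \<Longrightarrow> symm N (F a) (F b) = symm M a b"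
begin

lemmas transfer = homs idn cmp tens tunit tarr assc lun run symm

lemma is_isomorphism_image:
  "\<lbrakk>a \<in> objs M; b \<in> objs M\<rbrakk> \<Longrightarrow> is_isomorphism N (F a) (F b) f \<longleftrightarrow> is_isomorphism M a b f"
  by (simp add: is_isomorphism_def transfer)

lemma isomorphic_in_image:
  "\<lbrakk>a \<in> objs M; b \<in> objs M\<rbrakk> \<Longrightarrow> isomorphic_in N (F a) (F b) \<longleftrightarrow> isomorphic_in M a b"
  by (simp add: isomorphic_in_def is_isomorphism_image)

lemma symmetric_two_group_image:
  assumes "symmetric_two_group M"
  shows "symmetric_two_group N"
proof -
  interpret M: symmetric_two_group M by fact
  note [simp] = transfer is_isomorphism_image isomorphic_in_image objs M.tens_in M.tunit_in
  interpret N: category N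
    by (unfold_locales; clarsimp; rule M.idn_in M.cmp_in M.cmp_idn_right M.cmp_idn_left M.cmp_assoc; assumption)
  show ?thesis
    by (unfold_locales; clarsimp;
        (rule M.all_iso M.invertible M.tarr_in M.tarr_idn M.tarr_cmp M.assc_iso M.assc_natural
          M.lun_iso M.lun_natural M.run_iso M.run_natural M.symm_iso M.symm_natural M.pentagon
          M.triangle M.hexagon M.symm_symm; assumption)?)
qed

lemma strict_monoidal_functor:
  assumes "category M" "\<And>a b. \<lbrakk>a \<in> objs M; b \<in> objs M\<rbrakk> \<Longrightarrow> tens M a b \<in> objs M" "tunit M \<in> objs M"
  shows "symmetric_strict_monoidal_functor M N F (\<lambda>a b f. f)"
  using assms(2-) by unfold_locales (simp_all add: transfer objs)

lemma equivalence_if_left_inverse: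
  assumes "category M" and G: "\<And>a. a \<in> objs M \<Longrightarrow> G (F a) = a"
  shows "equivalence_of_categories M N F (\<lambda>a b f. f)"
proof -
  interpret category M by fact
  have "is_isomorphism M a a (idn M a)" if "a \<in> objs M" for a
    unfolding is_isomorphism_def using that idn_in cmp_idn_left by blast
  then have "natural_isomorphism M M (\<lambda>a. a) (\<lambda>a b f. f) (\<lambda>a. G (F a)) (\<lambda>a b f. f) (idn M)"
    and "natural_isomorphism N N (\<lambda>x. F (G x)) (\<lambda>x y f. f) (\<lambda>x. x) (\<lambda>x y f. f) (idn N)"
    unfolding natural_isomorphism_def
    by (auto simp: objs G transfer is_isomorphism_image cmp_idn_left cmp_idn_right)
  moreover have "cat_functor M N F (\<lambda>a b f. f)" "cat_functor N M G (\<lambda>a b f. f)"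
    by (unfold_locales; auto simp: objs G transfer)+
  ultimately show ?thesis unfolding equivalence_of_categories_def by blast
qed

end

section \<open>Extensions as butterflies\<close>

definition ext_of_bfly :: "('b, 'c, 'e) endo_bfly \<Rightarrow> ('b, 'c, 'e) extn" where
  "ext_of_bfly E = \<lparr>egrp = bgrp E, incl = cod_in E, proj = dom_out E\<rparr>"

lemma ext_of_bfly_Phi_obj [simp]: "ext_of_bfly (Phi_obj B X) = X"
  by (simp add: ext_of_bfly_def Phi_obj_def)

lemma Phi_obj_simps [simp]:
  "bgrp (Phi_obj B X) = egrp X" "cod_in (Phi_obj B X) = incl X"
  "dom_in (Phi_obj B X) = (\<lambda>b \<in> carrier B. inv\<^bsub>egrp X\<^esub> (incl X b))"
  "dom_out (Phi_obj B X) = proj X" "cod_out (Phi_obj B X) = proj X"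
  by (simp_all add: Phi_obj_def)

lemma bfly_pullback_Phi_obj [simp]:
  "bfly_pullback (Phi_obj B X) (Phi_obj B Y) = pullback_group (egrp X) (egrp Y) (proj X) (proj Y)"
  by (simp add: bfly_pullback_def)

context module_extensions
begin

lemma I_xmod_crossed_module: "crossed_module (I_xmod C B \<xi>)"
proof -
  have "\<xi> \<in> hom C (AutoGroup B)" using module by (simp add: group_module_def)
  then show ?thesis
    using C.group_axioms B.group_axioms
    by (auto simp: crossed_module_def I_xmod_def ehom_def hom_def B.m_comm B.m_assoc)
      (simp add: B.m_comm B.m_assoc[symmetric])
qed

lemma Phi_obj_in:
  assumes X: "X \<in> Obj" shows "Phi_obj B X \<in> Eq_objs C B \<xi>"
proof -
  note x = opextD[OF X]
  interpret G: group "egrp X" by (rule x(1))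
  have inv_hom: "inv\<^bsub>egrp X\<^esub> incl X (b \<otimes>\<^bsub>B\<^esub> b') = inv\<^bsub>egrp X\<^esub> incl X b \<otimes>\<^bsub>egrp X\<^esub> inv\<^bsub>egrp X\<^esub> incl X b'"
    if "b \<in> carrier B" "b' \<in> carrier B" for b b'
    using that X by (simp add: B.m_comm[of b b'] incl_mult G.inv_mult_group)
  interpret p: group_hom "egrp X" C "proj X" by unfold_locales (rule x(5))
  have conj: "inv\<^bsub>egrp X\<^esub> incl X (\<xi> (proj X e) b) = e \<otimes>\<^bsub>egrp X\<^esub> inv\<^bsub>egrp X\<^esub> incl X b \<otimes>\<^bsub>egrp X\<^esub> inv\<^bsub>egrp X\<^esub> e"
    if "e \<in> carr X" "b \<in> carrier B" for e b
    using that X by (simp add: x(9) G.inv_mult_group G.m_assoc)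
  show ?thesis
    using X x I_xmod_crossed_module inv_hom conj
    by (auto simp: Eq_objs_def butterfly_def I_xmod_def ehom_def hom_def)
qed

lemma ext_of_bfly_in:
  assumes "E \<in> Eq_objs C B \<xi>"
  shows "ext_of_bfly E \<in> Obj" "Phi_obj B (ext_of_bfly E) = E"
  using assms C.group_axioms B.group_axioms
  by (auto simp: Eq_objs_def butterfly_def I_xmod_def opext_def is_extension_def
      ext_of_bfly_def Phi_obj_def)

text \<open>
  For a butterfly \<open>(E, -\<kappa>, \<kappa>, \<gamma>, \<gamma>)\<close> the axioms amount to exactness of \<open>\<kappa>\<close>, \<open>\<gamma>\<close> and the conjugation
  formula, which also gives the one for \<open>-\<kappa>\<close>. So \<open>\<Phi>\<close> is bijective on objects.
\<close>

lemma Eq_objs_eq_image: "Eq_objs C B \<xi> = Phi_obj B ` Obj"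
  using Phi_obj_in ext_of_bfly_in by (metis (no_types, lifting) image_eqI image_subsetI subsetI subset_antisym)

lemma Eq_hom_Phi_obj:
  assumes "X \<in> Obj" "Y \<in> Obj"
  shows "Eq_hom B (Phi_obj B X) (Phi_obj B Y) = ext_hom B X Y"
  using ext_hom_bij[OF assms] by (auto simp: Eq_hom_def ext_hom_def ehom_def iso_def)

end

context baer_sums
begin

text \<open>
  A pushforward along the codiagonal is a cokernel of \<open>b \<mapsto> (\<kappa> b, - \<kappa>' b)\<close>: the kernel of \<open>q\<close> is the orbit
  of the unit under the antidiagonal, which is exactly the image of this map, and that image is
  normal, being a kernel.
\<close>

lemma q_cokernel:
  assumes X: "X \<in> Obj" and Y: "Y \<in> Obj"
  shows "bfly_cokernel (I_xmod C B \<xi>) (Phi_obj B X) (Phi_obj B Y) (egrp (X \<boxplus> Y)) (q X Y)"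
proof -
  let ?P = "pullback_group (egrp X) (egrp Y) (proj X) (proj Y)"
  let ?j = "\<lambda>b. (incl X b, inv\<^bsub>egrp Y\<^esub> incl Y b)"
  interpret P: group ?P by (rule fibre_group[OF X Y])
  interpret S: group "egrp (X \<boxplus> Y)" by (intro opextD(1) bsum_in X Y)
  interpret Y: group "egrp Y" by (rule opextD(1)[OF Y])
  interpret q: group_hom ?P "egrp (X \<boxplus> Y)" "q X Y"
    by unfold_locales (use q_hom[OF X Y] in \<open>simp add: ehom_def\<close>)
  have i: "group_hom B (egrp Y) (incl Y)" by unfold_locales (rule opextD(2)[OF Y])
  have inv: "inv\<^bsub>egrp Y\<^esub> incl Y b = incl Y (inv\<^bsub>B\<^esub> b)" if "b \<in> carrier B" for b
    using group_hom.hom_inv[OF i that] by simp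
  have ker: "kernel ?P (egrp (X \<boxplus> Y)) (q X Y) = ?j ` carrier B"
  proof (intro equalityI subsetI)
    fix z assume z: "z \<in> kernel ?P (egrp (X \<boxplus> Y)) (q X Y)"
    then obtain e e' where e: "z = (e, e')" "e \<in> carr X" "e' \<in> carr Y" "proj X e = proj Y e'"
      by (cases z) (auto simp: kernel_def)
    have "q X Y (\<one>\<^bsub>egrp X\<^esub>, \<one>\<^bsub>egrp Y\<^esub>) = q X Y (e, e')" using z e q.hom_one by (simp add: kernel_def)
    then obtain b where b: "b \<in> carrier B" "e = act X b \<one>\<^bsub>egrp X\<^esub>" "e' = act Y (inv\<^bsub>B\<^esub> b) \<one>\<^bsub>egrp Y\<^esub>"
      by (rule q_eq_cases[OF X Y, rotated 6]) (use e X Y in auto)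
    then have "e = incl X b" "e' = incl Y (inv\<^bsub>B\<^esub> b)"
      using X Y by (simp_all add: incl_eq_act)
    then show "z \<in> ?j ` carrier B"
      using b(1) by (intro image_eqI[of _ _ b]) (simp_all add: e inv)
  next
    fix z assume "z \<in> ?j ` carrier B"
    then obtain b where b: "b \<in> carrier B" "z = (incl X b, incl Y (inv\<^bsub>B\<^esub> b))"
      using inv by (metis (no_types, lifting) imageE)
    have "q X Y z = incl (X \<boxplus> Y) \<one>\<^bsub>B\<^esub>" using b X Y by (simp add: q_incl)
    also have "\<dots> = \<one>\<^bsub>egrp (X \<boxplus> Y)\<^esub>" using X Y by (simp add: incl_eq_act)
    finally show "z \<in> kernel ?P (egrp (X \<boxplus> Y)) (q X Y)"
      using b X Y by (simp add: kernel_def)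
  qed
  have "?j ` carrier B \<lhd> ?P" using q.normal_kernel unfolding ker .
  then have "?j ` carrier B = \<Inter>{N. N \<lhd> ?P \<and> ?j ` carrier B \<subseteq> N}" by blast
  moreover have "(\<lambda>k. (incl X k, (\<lambda>b \<in> carrier B. inv\<^bsub>egrp Y\<^esub> incl Y b) k)) ` carrier B = ?j ` carrier B"
    by (rule image_cong) simp_all
  ultimately show ?thesis
    using ker q_hom[OF X Y] q_surj[OF X Y] S.group_axioms
    by (simp add: bfly_cokernel_def is_cokernel_def I_xmod_def)
qed

text \<open>
  Tensor products correspond: with the same group and the same \<open>q\<close>, the four maps of the composite
  butterfly are forced by \<open>q_incl\<close> and \<open>proj_q\<close>.
\<close>

lemma bfly_comp_Phi_obj:
  assumes X: "X \<in> Obj" and Y: "Y \<in> Obj"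
  shows "bfly_comp (I_xmod C B \<xi>) (I_xmod C B \<xi>) (egrp (X \<boxplus> Y), q X Y) (Phi_obj B Y) (Phi_obj B X) =
    Phi_obj B (X \<boxplus> Y)"
proof -
  let ?P = "pullback_group (egrp X) (egrp Y) (proj X) (proj Y)"
  note s = opextD[OF bsum_in[OF X Y]]
  interpret X: group "egrp X" by (rule opextD(1)[OF X])
  interpret S: group "egrp (X \<boxplus> Y)" by (rule s(1))
  interpret i: group_hom B "egrp X" "incl X" by unfold_locales (rule opextD(2)[OF X])
  interpret j: group_hom B "egrp (X \<boxplus> Y)" "incl (X \<boxplus> Y)" by unfold_locales (rule s(2))
  have left: "q X Y (incl X b, \<one>\<^bsub>egrp Y\<^esub>) = incl (X \<boxplus> Y) b" if "b \<in> carrier B" for b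
    using q_incl[of X Y b "\<one>\<^bsub>B\<^esub>"] that X Y by (simp add: incl_eq_act[of Y "\<one>\<^bsub>B\<^esub>"])
  have right: "q X Y (\<one>\<^bsub>egrp X\<^esub>, incl Y b) = incl (X \<boxplus> Y) b" if "b \<in> carrier B" for b
    using q_incl[of X Y "\<one>\<^bsub>B\<^esub>" b] that X Y by (simp add: incl_eq_act[of X "\<one>\<^bsub>B\<^esub>"])
  have "(\<lambda>b \<in> carrier B. q X Y (inv\<^bsub>egrp X\<^esub> incl X b, \<one>\<^bsub>egrp Y\<^esub>)) =
      (\<lambda>b \<in> carrier B. inv\<^bsub>egrp (X \<boxplus> Y)\<^esub> incl (X \<boxplus> Y) b)"
    by (rule restrict_ext) (simp add: i.hom_inv[symmetric] j.hom_inv[symmetric] left del: i.hom_inv j.hom_inv)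
  moreover have "(\<lambda>b \<in> carrier B. q X Y (\<one>\<^bsub>egrp X\<^esub>, incl Y b)) = incl (X \<boxplus> Y)"
    using s(3) right by (auto simp: extensional_def fun_eq_iff)
  moreover have "induced (carrier ?P) (egrp (X \<boxplus> Y)) (q X Y) (\<lambda>(e, e'). proj X e) = proj (X \<boxplus> Y)"
    by (rule induced_eqI[OF q_surj[OF X Y] s(6)]) (use X Y in auto)
  moreover have "induced (carrier ?P) (egrp (X \<boxplus> Y)) (q X Y) (\<lambda>(e, e'). proj Y e') = proj (X \<boxplus> Y)"
    by (rule induced_eqI[OF q_surj[OF X Y] s(6)]) (use X Y in auto)
  ultimately show ?thesis
    by (simp add: bfly_comp_def I_xmod_def Phi_obj_def bfly_pullback_def cong: restrict_cong)
qed

end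

section \<open>The equivalence\<close>

text \<open>
  Any choice of Baer sums is also a choice of cokernels, read through the bijection on objects.
\<close>

lemma (in module_extensions) compatible_choices_exist:
  "\<exists>(P :: ('b, 'c, 'e) baer_choice) (K :: ('b, 'c, 'e) coker_choice). compatible_choices C B \<xi> P K"
proof -
  have "\<exists>p :: ('b, 'c, 'e) extn \<times> _. fst p \<in> Obj \<and> is_pushforward C (B \<times>\<times> B) (fibre_product B X Y)
      (\<lambda>(b, b'). b \<otimes>\<^bsub>B\<^esub> b') B (fst p) (snd p)"
    if "X \<in> Obj" "Y \<in> Obj" for X Y :: "('b, 'c, 'e) extn"
  proof -
    obtain S :: "('b, 'c, 'e) extn" and q where "S \<in> Obj" "is_pushforward C (B \<times>\<times> B) (fibre_product B X Y)
        (\<lambda>(b, b'). b \<otimes>\<^bsub>B\<^esub> b') B S q"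
      using baer_sum_exists[OF \<open>X \<in> Obj\<close> \<open>Y \<in> Obj\<close>] by blast
    then show ?thesis by (intro exI[of _ "(S, q)"]) simp
  qed
  then obtain P :: "('b, 'c, 'e) baer_choice" where P: "is_baer_choice C B \<xi> P"
    unfolding is_baer_choice_def by metis
  interpret baer_sums C B \<xi> P by unfold_locales (rule P)
  define K :: "('b, 'c, 'e) coker_choice" where
    "K E F = (let p = P (ext_of_bfly E) (ext_of_bfly F) in (egrp (fst p), snd p))" for E F
  have "is_coker_choice C B \<xi> K"
    unfolding is_coker_choice_def Eq_objs_eq_image by (auto simp: K_def Let_def q_cokernel)
  then have "compatible_choices C B \<xi> P K"
    using P by (simp add: compatible_choices_def K_def Let_def)
  then show ?thesis by blast
qed

text \<open>
  Once the groups and the maps \<open>q\<close> agree, the structural arrows on both sides are induced by the same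
  formulas on the same sets.
\<close>

lemma (in pointed_baer_sums) Phi_arrow_preserving_strict:
  assumes K: "\<And>X Y. \<lbrakk>X \<in> Obj; Y \<in> Obj\<rbrakk> \<Longrightarrow> K (Phi_obj B X) (Phi_obj B Y) = (egrp (X \<boxplus> Y), q X Y)"
  shows "arrow_preserving_strict M (EqI C B \<xi> \<iota> K) (Phi_obj B)"
proof -
  have unit: "id_bfly C B \<xi> \<iota> = Phi_obj B U"
    by (simp add: id_bfly_def split_ext_def Phi_obj_def Let_def)
  show ?thesis
    by unfold_locales
      (simp_all add: H2_def EqI_def Let_def Eq_objs_eq_image Eq_hom_Phi_obj bfly_comp_Phi_obj K unit)
qed

theorem theorem4p7:
  fixes C :: "'c monoid" and B :: "'b monoid" and \<xi> :: "'c \<Rightarrow> 'b \<Rightarrow> 'b"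
    and \<iota> :: "'b \<times> 'c \<Rightarrow> 'e"
  assumes "group_module C B \<xi>"
    and "inj_on \<iota> (carrier B \<times> carrier C)"
  shows "(\<exists>(P :: ('b, 'c, 'e) baer_choice) (K :: ('b, 'c, 'e) coker_choice).
            compatible_choices C B \<xi> P K) \<and>
         (\<forall>(P :: ('b, 'c, 'e) baer_choice) (K :: ('b, 'c, 'e) coker_choice).
            compatible_choices C B \<xi> P K \<longrightarrow>
              symmetric_two_group (H2 C B \<xi> \<iota> P) \<and>
              symmetric_two_group (EqI C B \<xi> \<iota> K) \<and>
              symmetric_strict_monoidal_equivalence (H2 C B \<xi> \<iota> P) (EqI C B \<xi> \<iota> K)
                (Phi_obj B) Phi_arr)"
proof (intro conjI allI impI)
  interpret module_extensions C B \<xi> by unfold_locales (rule assms(1))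
  show "\<exists>(P :: ('b, 'c, 'e) baer_choice) (K :: ('b, 'c, 'e) coker_choice). compatible_choices C B \<xi> P K"
    by (rule compatible_choices_exist)
next
  fix P :: "('b, 'c, 'e) baer_choice" and K :: "('b, 'c, 'e) coker_choice"
  assume PK: "compatible_choices C B \<xi> P K"
  interpret pointed_baer_sums C B \<xi> P \<iota>
    by unfold_locales (use assms PK in \<open>simp_all add: compatible_choices_def\<close>)
  interpret arrow_preserving_strict "H2 C B \<xi> \<iota> P" "EqI C B \<xi> \<iota> K" "Phi_obj B"
    by (rule Phi_arrow_preserving_strict) (use PK in \<open>simp add: compatible_choices_def\<close>)
  have arr: "Phi_arr = (\<lambda>X Y (\<sigma> :: 'e \<Rightarrow> 'e). \<sigma>)" by (intro ext) (simp add: Phi_arr_def)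
  interpret symmetric_two_group "H2 C B \<xi> \<iota> P" by (rule H2_symmetric_two_group)
  show "symmetric_two_group (H2 C B \<xi> \<iota> P)" by (rule H2_symmetric_two_group)
  then show "symmetric_two_group (EqI C B \<xi> \<iota> K)" by (rule symmetric_two_group_image)
  have "symmetric_strict_monoidal_functor M (EqI C B \<xi> \<iota> K) (Phi_obj B) Phi_arr"
    unfolding arr by (rule strict_monoidal_functor[OF category_axioms]) (rule tens_in tunit_in; assumption?)+
  moreover have "equivalence_of_categories M (EqI C B \<xi> \<iota> K) (Phi_obj B) Phi_arr"
    unfolding arr by (rule equivalence_if_left_inverse[where G = ext_of_bfly, OF category_axioms]) simp
  ultimately show "symmetric_strict_monoidal_equivalence M (EqI C B \<xi> \<iota> K) (Phi_obj B) Phi_arr"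
    by (simp add: symmetric_strict_monoidal_equivalence_def)
qed

end
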